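(* Let $\mathcal L(z_1,z_2)=\widehat{\mathcal L}(z_1,z_2)z_1^{X_1}z_2^{X_2}$ be the fundamental solution, normalized at $(0,0)$, of the KZ equation of two variables. Then $$\mathcal L(z_1,z_2)=\mathcal L^{(2)}_{2\otimes1}(z_1,z_2)\,\mathcal L^{(1)}_{2\otimes1}(z_1)=\mathcal L^{(1)}_{1\otimes2}(z_1,z_2)\,\mathcal L^{(2)}_{1\otimes2}(z_2).$$ Here, for $(i,j)=(2,1)$ and $(i,j)=(1,2)$: - $\mathcal L^{(j)}_{i\otimes j}(z_j)$ is the fundamental solution normalized at $z_j=0$ of $$\frac{dG}{dz_j}=\left(\frac{X_j}{z_j}+\frac{X_{jj}}{1-z_j}\right)G,\qquad \mathcal L^{(j)}_{i\otimes j}(z_j)=\widehat{\mathcal L}^{(j)}_{i\otimes j}(z_j)\,z_j^{X_j},\quad \widehat{\mathcal L}^{(j)}_{i\otimes j}(0)=\mathbf I;$$ - $\mathcal L^{(i)}_{i\otimes j}(z_1,z_2)$ is the fundamental solution normalized at $z_i=0$ of $$\frac{dG}{dz_i}=\left(\frac{X_i}{z_i}+\frac{X_{ii}}{1-z_i}+\frac{z_jX_{12}}{1-z_1z_2}\right)G,\qquad \mathcal L^{(i)}_{i\otimes j}(z_1,z_2)=\widehat{\mathcal L}^{(i)}_{i\otimes j}(z_1,z_2)\,z_i^{X_i},\quad \widehat{\mathcal L}^{(i)}_{i\otimes j}\Big|_{z_i=0}=\mathbf I$$ (an ordinary differential equation in $z_i$ with $z_j$ as a parameter). The holomorphic part decomposes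 similarly: $$\widehat{\mathcal L}(z_1,z_2)=\widehat{\mathcal L}^{(2)}_{2\otimes1}(z_1,z_2)\,\widehat{\mathcal L}^{(1)}_{2\otimes1}(z_1)=\widehat{\mathcal L}^{(1)}_{1\otimes2}(z_1,z_2)\,\widehat{\mathcal L}^{(2)}_{1\otimes2}(z_2).$$
   Context: $\mathfrak X$ is the complex Lie algebra generated by $X_1,X_{11},X_2,X_{22},X_{12}$ with defining relations $$[X_1,X_2]=[X_{11},X_2]=[X_1,X_{22}]=0,\qquad [X_{11},X_{22}]=[-X_{11},X_{12}]=[X_{22},X_{12}]=[-X_1+X_2,X_{12}].$$ $\mathcal U=\mathcal U(\mathfrak X)$ is its universal enveloping algebra, graded with each generator in degree 1; $\widetilde{\mathcal U}$ is the completion with respect to this grading, with unit $\mathbf I$. All functions take values in $\widetilde{\mathcal U}$, holomorphy is understood degree by degree, and $z_i^{X_i}=\exp(X_i\log z_i)$ (with the same branch of $\log z_i$ throughout). The KZ equation of two variables is $$dG=\bigl(\xi_1X_1+\xi_{11}X_{11}+\xi_2X_2+\xi_{22}X_{22}+\xi_{12}X_{12}\bigr)G,$$ $$\xi_i=\frac{dz_i}{z_i},\quad \xi_{ii}=\frac{dz_i}{1-z_i}\ (i=1,2),\quad \xi_{12}=\frac{d(z_1z_2)}{1-z_1z_2}.$$ Its fundamental solution normalized at $(0,0)$ is the unique solution $\mathcal L(z_1,z_2)=\widehat{\mathcal L}(z_1,z_2)z_1^{X_1}z_2^{X_2}$ with $\widehat{\mathcal L}$ holomorphic at $(0,0)$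 and $\widehat{\mathcal L}(0,0)=\mathbf I$. Likewise, for the one-variable equations in the claim, "fundamental solution normalized at $z_k=0$" means the unique solution of the displayed form (holomorphic part times $z_k^{X_k}$) whose holomorphic part is holomorphic at $z_k=0$ and equals $\mathbf I$ at $z_k=0$. *)

theory Defs
  imports "HOL-Complex_Analysis.Complex_Analysis" "HOL-Computational_Algebra.Formal_Power_Series"
begin

section \<open>Complex vector spaces, algebras and Lie algebras\<close>

class scaleC =
  fixes scaleC :: "complex \<Rightarrow> 'a \<Rightarrow> 'a"  (infixr \<open>*\<^sub>C\<close> 75)

class complex_vector = scaleC + ab_group_add +
  assumes scaleC_add_right: "a *\<^sub>C (x + y) = a *\<^sub>C x + a *\<^sub>C y"
    and scaleC_add_left: "(a + b) *\<^sub>C x = a *\<^sub>C x + b *\<^sub>C x"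
    and scaleC_scaleC: "a *\<^sub>C b *\<^sub>C x = (a * b) *\<^sub>C x"
    and scaleC_one: "1 *\<^sub>C x = x"

global_interpretation complex_vector: vector_space "scaleC :: complex \<Rightarrow> 'a \<Rightarrow> 'a::complex_vector"
  by unfold_locales
    (fact scaleC_add_right scaleC_add_left scaleC_scaleC scaleC_one)+

class complex_algebra_1 = complex_vector + ring_1 +
  assumes mult_scaleC_left: "(a *\<^sub>C x) * y = a *\<^sub>C (x * y)"
    and mult_scaleC_right: "x * (a *\<^sub>C y) = a *\<^sub>C (x * y)"

class complex_lie_algebra = complex_vector +
  fixes lie :: "'a \<Rightarrow> 'a \<Rightarrow> 'a"
  assumes lie_add_left: "lie (x + y) z = lie x z + lie y z"
    and lie_add_right: "lie x (y + z) = lie x y + lie x z"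
    and lie_scaleC_left: "lie (a *\<^sub>C x) y = a *\<^sub>C lie x y"
    and lie_scaleC_right: "lie x (a *\<^sub>C y) = a *\<^sub>C lie x y"
    and lie_self: "lie x x = 0"
    and lie_jacobi: "lie x (lie y z) + lie y (lie z x) + lie z (lie x y) = 0"

abbreviation complex_functional :: "('a::complex_vector \<Rightarrow> complex) \<Rightarrow> bool" where
  "complex_functional \<equiv> Vector_Spaces.linear scaleC (*)"

section \<open>The Lie algebra presented by generators and relations\<close>

datatype kz_gen = X1 | X11 | X2 | X22 | X12

datatype kz_lterm =
    LGen kz_gen | LZero | LAdd kz_lterm kz_lterm | LScale complex kz_lterm | LBr kz_lterm kz_lterm

inductive kz_rel :: "kz_lterm \<Rightarrow> kz_lterm \<Rightarrow> bool" where
  "kz_rel (LBr (LGen X1) (LGen X2)) LZero"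
| "kz_rel (LBr (LGen X11) (LGen X2)) LZero"
| "kz_rel (LBr (LGen X1) (LGen X22)) LZero"
| "kz_rel (LBr (LGen X11) (LGen X22)) (LBr (LScale (-1) (LGen X11)) (LGen X12))"
| "kz_rel (LBr (LScale (-1) (LGen X11)) (LGen X12)) (LBr (LGen X22) (LGen X12))"
| "kz_rel (LBr (LGen X22) (LGen X12)) (LBr (LAdd (LScale (-1) (LGen X1)) (LGen X2)) (LGen X12))"

text \<open>The least congruence on Lie terms that contains the Lie algebra axioms and the defining
  relations; the quotient is the Lie algebra presented by these generators and relations.\<close>

inductive kz_lcong :: "kz_lterm \<Rightarrow> kz_lterm \<Rightarrow> bool" where
  rel: "kz_rel x y \<Longrightarrow> kz_lcong x y"
| refl: "kz_lcong x x"
| sym: "kz_lcong x y \<Longrightarrow> kz_lcong y x"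
| trans: "kz_lcong x y \<Longrightarrow> kz_lcong y z \<Longrightarrow> kz_lcong x z"
| add_cong: "kz_lcong x x' \<Longrightarrow> kz_lcong y y' \<Longrightarrow> kz_lcong (LAdd x y) (LAdd x' y')"
| scale_cong: "kz_lcong x x' \<Longrightarrow> kz_lcong (LScale a x) (LScale a x')"
| br_cong: "kz_lcong x x' \<Longrightarrow> kz_lcong y y' \<Longrightarrow> kz_lcong (LBr x y) (LBr x' y')"
| add_assoc: "kz_lcong (LAdd (LAdd x y) z) (LAdd x (LAdd y z))"
| add_commute: "kz_lcong (LAdd x y) (LAdd y x)"
| add_zero: "kz_lcong (LAdd LZero x) x"
| scale_add_right: "kz_lcong (LScale a (LAdd x y)) (LAdd (LScale a x) (LScale a y))"
| scale_add_left: "kz_lcong (LScale (a + b) x) (LAdd (LScale a x) (LScale b x))"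
| scale_scale: "kz_lcong (LScale a (LScale b x)) (LScale (a * b) x)"
| scale_one: "kz_lcong (LScale 1 x) x"
| scale_zero: "kz_lcong (LScale 0 x) LZero"
| br_add_left: "kz_lcong (LBr (LAdd x y) z) (LAdd (LBr x z) (LBr y z))"
| br_add_right: "kz_lcong (LBr x (LAdd y z)) (LAdd (LBr x y) (LBr x z))"
| br_scale_left: "kz_lcong (LBr (LScale a x) y) (LScale a (LBr x y))"
| br_scale_right: "kz_lcong (LBr x (LScale a y)) (LScale a (LBr x y))"
| br_self: "kz_lcong (LBr x x) LZero"
| jacobi: "kz_lcong (LAdd (LAdd (LBr x (LBr y z)) (LBr y (LBr z x))) (LBr z (LBr x y))) LZero"

quotient_type kz_lie = kz_lterm / kz_lcong
  by (rule equivpI)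
    (auto simp: reflp_def symp_def transp_def intro: kz_lcong.refl kz_lcong.sym kz_lcong.trans)

instantiation kz_lie :: complex_lie_algebra
begin

lift_definition zero_kz_lie :: kz_lie is LZero .
lift_definition plus_kz_lie :: "kz_lie \<Rightarrow> kz_lie \<Rightarrow> kz_lie" is LAdd by (rule kz_lcong.add_cong)
lift_definition scaleC_kz_lie :: "complex \<Rightarrow> kz_lie \<Rightarrow> kz_lie" is LScale by (rule kz_lcong.scale_cong)
lift_definition lie_kz_lie :: "kz_lie \<Rightarrow> kz_lie \<Rightarrow> kz_lie" is LBr by (rule kz_lcong.br_cong)
lift_definition uminus_kz_lie :: "kz_lie \<Rightarrow> kz_lie" is "LScale (-1)" by (rule kz_lcong.scale_cong)
lift_definition minus_kz_lie :: "kz_lie \<Rightarrow> kz_lie \<Rightarrow> kz_lie" is "\<lambda>x y. LAdd x (LScale (-1) y)"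
  by (intro kz_lcong.add_cong kz_lcong.scale_cong)

instance
proof
  fix x :: kz_lie
  show "- x + x = 0"
  proof transfer
    fix x
    have "kz_lcong (LAdd (LScale (-1) x) x) (LAdd (LScale (-1) x) (LScale 1 x))"
      by (intro kz_lcong.add_cong kz_lcong.refl kz_lcong.sym[OF kz_lcong.scale_one])
    moreover have "kz_lcong (LAdd (LScale (-1) x) (LScale 1 x)) (LScale (-1 + 1) x)"
      by (rule kz_lcong.sym[OF kz_lcong.scale_add_left])
    moreover have "kz_lcong (LScale (-1 + 1) x) LZero"
      using kz_lcong.scale_zero by simp
    ultimately show "kz_lcong (LAdd (LScale (-1) x) x) LZero"
      by (rule kz_lcong.trans[OF _ kz_lcong.trans])
  qed
qed (transfer; rule kz_lcong.refl kz_lcong.add_assoc kz_lcong.add_commute kz_lcong.add_zero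
    kz_lcong.scale_add_right kz_lcong.scale_add_left kz_lcong.scale_scale kz_lcong.scale_one
    kz_lcong.br_add_left kz_lcong.br_add_right kz_lcong.br_scale_left kz_lcong.br_scale_right
    kz_lcong.br_self kz_lcong.jacobi)+

end

lift_definition kz_lie_gen :: "kz_gen \<Rightarrow> kz_lie" is LGen .

section \<open>Universal enveloping algebras\<close>

datatype 'x uterm =
    UIn 'x | UZero | UOne | UAdd "'x uterm" "'x uterm" | UScale complex "'x uterm"
  | UMult "'x uterm" "'x uterm"

text \<open>The least congruence that contains the axioms of unital associative algebras, linearity of
  the inclusion of the Lie algebra, and \<open>x y - y x = [x, y]\<close>; the quotient is the tensor
  algebra modulo the ideal generated by the elements \<open>x y - y x - [x, y]\<close>.\<close>

inductive ucong :: "'x::complex_lie_algebra uterm \<Rightarrow> 'x uterm \<Rightarrow> bool" where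
  refl: "ucong u u"
| sym: "ucong u v \<Longrightarrow> ucong v u"
| trans: "ucong u v \<Longrightarrow> ucong v w \<Longrightarrow> ucong u w"
| add_cong: "ucong u u' \<Longrightarrow> ucong v v' \<Longrightarrow> ucong (UAdd u v) (UAdd u' v')"
| scale_cong: "ucong u u' \<Longrightarrow> ucong (UScale a u) (UScale a u')"
| mult_cong: "ucong u u' \<Longrightarrow> ucong v v' \<Longrightarrow> ucong (UMult u v) (UMult u' v')"
| add_assoc: "ucong (UAdd (UAdd u v) w) (UAdd u (UAdd v w))"
| add_commute: "ucong (UAdd u v) (UAdd v u)"
| add_zero: "ucong (UAdd UZero u) u"
| scale_add_right: "ucong (UScale a (UAdd u v)) (UAdd (UScale a u) (UScale a v))"
| scale_add_left: "ucong (UScale (a + b) u) (UAdd (UScale a u) (UScale b u))"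
| scale_scale: "ucong (UScale a (UScale b u)) (UScale (a * b) u)"
| scale_one: "ucong (UScale 1 u) u"
| scale_zero: "ucong (UScale 0 u) UZero"
| mult_assoc: "ucong (UMult (UMult u v) w) (UMult u (UMult v w))"
| mult_one_left: "ucong (UMult UOne u) u"
| mult_one_right: "ucong (UMult u UOne) u"
| mult_add_left: "ucong (UMult (UAdd u v) w) (UAdd (UMult u w) (UMult v w))"
| mult_add_right: "ucong (UMult u (UAdd v w)) (UAdd (UMult u v) (UMult u w))"
| mult_scale_left: "ucong (UMult (UScale a u) v) (UScale a (UMult u v))"
| mult_scale_right: "ucong (UMult u (UScale a v)) (UScale a (UMult u v))"
| in_add: "ucong (UIn (x + y)) (UAdd (UIn x) (UIn y))"
| in_scale: "ucong (UIn (a *\<^sub>C x)) (UScale a (UIn x))"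
| in_lie: "ucong (UAdd (UMult (UIn x) (UIn y)) (UScale (-1) (UMult (UIn y) (UIn x)))) (UIn (lie x y))"

quotient_type (overloaded) 'x uea = "'x::complex_lie_algebra uterm" / ucong
  by (rule equivpI)
    (auto simp: reflp_def symp_def transp_def intro: ucong.refl ucong.sym ucong.trans)

text \<open>The augmentation, needed only to see that \<open>0 \<noteq> 1\<close>.\<close>

primrec uaug :: "'x uterm \<Rightarrow> complex" where
  "uaug (UIn x) = 0"
| "uaug UZero = 0"
| "uaug UOne = 1"
| "uaug (UAdd u v) = uaug u + uaug v"
| "uaug (UScale a u) = a * uaug u"
| "uaug (UMult u v) = uaug u * uaug v"

lemma ucong_uaug: "ucong u v \<Longrightarrow> uaug u = uaug v"
  by (induction rule: ucong.induct) (auto simp: algebra_simps)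

instantiation uea :: (complex_lie_algebra) complex_algebra_1
begin

lift_definition zero_uea :: "'a uea" is UZero .
lift_definition one_uea :: "'a uea" is UOne .
lift_definition plus_uea :: "'a uea \<Rightarrow> 'a uea \<Rightarrow> 'a uea" is UAdd by (rule ucong.add_cong)
lift_definition scaleC_uea :: "complex \<Rightarrow> 'a uea \<Rightarrow> 'a uea" is UScale by (rule ucong.scale_cong)
lift_definition times_uea :: "'a uea \<Rightarrow> 'a uea \<Rightarrow> 'a uea" is UMult by (rule ucong.mult_cong)
lift_definition uminus_uea :: "'a uea \<Rightarrow> 'a uea" is "UScale (-1)" by (rule ucong.scale_cong)
lift_definition minus_uea :: "'a uea \<Rightarrow> 'a uea \<Rightarrow> 'a uea" is "\<lambda>u v. UAdd u (UScale (-1) v)"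
  by (intro ucong.add_cong ucong.scale_cong)

instance
proof
  fix u :: "'a uea"
  show "- u + u = 0"
  proof transfer
    fix u :: "'a uterm"
    have "ucong (UAdd (UScale (-1) u) u) (UAdd (UScale (-1) u) (UScale 1 u))"
      by (intro ucong.add_cong ucong.refl ucong.sym[OF ucong.scale_one])
    moreover have "ucong (UAdd (UScale (-1) u) (UScale 1 u)) (UScale (-1 + 1) u)"
      by (rule ucong.sym[OF ucong.scale_add_left])
    moreover have "ucong (UScale (-1 + 1) u) UZero"
      using ucong.scale_zero by simp
    ultimately show "ucong (UAdd (UScale (-1) u) u) UZero"
      by (rule ucong.trans[OF _ ucong.trans])
  qed
  show "(0 :: 'a uea) \<noteq> 1"
    by transfer (auto dest: ucong_uaug)
qed (transfer; rule ucong.refl ucong.add_assoc ucong.add_commute ucong.add_zero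
    ucong.scale_add_right ucong.scale_add_left ucong.scale_scale ucong.scale_one
    ucong.mult_assoc ucong.mult_one_left ucong.mult_one_right ucong.mult_add_left
    ucong.mult_add_right ucong.mult_scale_left ucong.mult_scale_right)+

end

lift_definition uea_in :: "'x::complex_lie_algebra \<Rightarrow> 'x uea" is UIn .

lemma uea_in_lie: "uea_in (lie x y) = uea_in x * uea_in y - uea_in y * uea_in x"
  by transfer (rule ucong.sym[OF ucong.in_lie])

section \<open>The grading and the completion\<close>

definition kz_word :: "kz_gen list \<Rightarrow> kz_lie uea" where
  "kz_word ws = prod_list (map (\<lambda>g. uea_in (kz_lie_gen g)) ws)"

definition kz_grade :: "nat \<Rightarrow> kz_lie uea set" where
  "kz_grade n = complex_vector.span (kz_word ` {ws. length ws = n})"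

lemma kz_grade_zero: "0 \<in> kz_grade n"
  and kz_grade_add: "u \<in> kz_grade n \<Longrightarrow> v \<in> kz_grade n \<Longrightarrow> u + v \<in> kz_grade n"
  and kz_grade_scaleC: "u \<in> kz_grade n \<Longrightarrow> a *\<^sub>C u \<in> kz_grade n"
  and kz_grade_uminus: "u \<in> kz_grade n \<Longrightarrow> - u \<in> kz_grade n"
  and kz_grade_diff: "u \<in> kz_grade n \<Longrightarrow> v \<in> kz_grade n \<Longrightarrow> u - v \<in> kz_grade n"
  and kz_grade_sum: "(\<And>i. i \<in> A \<Longrightarrow> f i \<in> kz_grade n) \<Longrightarrow> sum f A \<in> kz_grade n"
  by (auto simp: kz_grade_def complex_vector.span_zero complex_vector.span_add
      complex_vector.span_scale complex_vector.span_neg complex_vector.span_diff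
      intro: complex_vector.span_sum)

lemma kz_grade_one: "1 \<in> kz_grade 0"
  by (auto simp: kz_grade_def kz_word_def intro: complex_vector.span_base)

lemma kz_grade_gen: "uea_in (kz_lie_gen g) \<in> kz_grade (Suc 0)"
  unfolding kz_grade_def
  by (rule complex_vector.span_base) (auto simp: kz_word_def intro!: image_eqI[of _ _ "[g]"])

lemma kz_grade_mult:
  assumes "u \<in> kz_grade m" "v \<in> kz_grade n"
  shows "u * v \<in> kz_grade (m + n)"
proof -
  have word: "kz_word ws * v \<in> kz_grade (m + n)" if "length ws = m" for ws
    using assms(2) unfolding kz_grade_def
  proof (induction v rule: complex_vector.span_induct_alt)
    case base
    then show ?case by (simp add: complex_vector.span_zero)
  next
    case (step c x y)
    obtain vs where x: "x = kz_word vs" "length vs = n" using step by auto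
    have "kz_word ws * x = kz_word (ws @ vs)" by (simp add: x kz_word_def)
    then have "kz_word ws * x \<in> complex_vector.span (kz_word ` {ws. length ws = m + n})"
      using that x by (auto intro!: complex_vector.span_base)
    then show ?case
      using step by (simp add: distrib_left mult_scaleC_right complex_vector.span_add complex_vector.span_scale)
  qed
  show ?thesis using assms(1) unfolding kz_grade_def[of m]
  proof (induction u rule: complex_vector.span_induct_alt)
    case base
    then show ?case by (simp add: kz_grade_zero)
  next
    case (step c x y)
    then show ?case using word
      by (auto simp: distrib_right mult_scaleC_left intro!: kz_grade_add kz_grade_scaleC)
  qed
qed

lemma kz_grade_fps_mult:
  assumes "\<forall>n. fps_nth F n \<in> kz_grade n" "\<forall>n. fps_nth G n \<in> kz_grade n"
  shows "fps_nth (F * G) n \<in> kz_grade n"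
  unfolding fps_mult_nth
proof (rule kz_grade_sum)
  fix i assume "i \<in> {0..n}"
  then show "fps_nth F i * fps_nth G (n - i) \<in> kz_grade n"
    using kz_grade_mult[of "fps_nth F i" i "fps_nth G (n - i)" "n - i"] assms by simp
qed

lemma kz_grade_fps_power:
  assumes "\<forall>n. fps_nth F n \<in> kz_grade n"
  shows "fps_nth (F ^ k) n \<in> kz_grade n"
proof (induction k arbitrary: n)
  case 0
  then show ?case by (simp add: kz_grade_zero kz_grade_one)
next
  case (Suc k)
  then show ?case using assms by (simp add: kz_grade_fps_mult)
qed

text \<open>The completion is the product of the homogeneous components, with the Cauchy product. The
  family of components \<open>u\<^sub>n\<close> is stored as the formal power series with coefficients \<open>u\<^sub>n\<close>.\<close>

typedef kz_cuea = "{F :: kz_lie uea fps. \<forall>n. fps_nth F n \<in> kz_grade n}"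
  by (rule exI[of _ 0]) (simp add: kz_grade_zero)

setup_lifting type_definition_kz_cuea

instantiation kz_cuea :: complex_algebra_1
begin

lift_definition zero_kz_cuea :: kz_cuea is 0 by (simp add: kz_grade_zero)
lift_definition one_kz_cuea :: kz_cuea is 1 by (simp add: kz_grade_zero kz_grade_one)
lift_definition plus_kz_cuea :: "kz_cuea \<Rightarrow> kz_cuea \<Rightarrow> kz_cuea" is "(+)" by (simp add: kz_grade_add)
lift_definition uminus_kz_cuea :: "kz_cuea \<Rightarrow> kz_cuea" is uminus by (simp add: kz_grade_uminus)
lift_definition minus_kz_cuea :: "kz_cuea \<Rightarrow> kz_cuea \<Rightarrow> kz_cuea" is "(-)" by (simp add: kz_grade_diff)
lift_definition scaleC_kz_cuea :: "complex \<Rightarrow> kz_cuea \<Rightarrow> kz_cuea"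
  is "\<lambda>a F. Abs_fps (\<lambda>n. a *\<^sub>C fps_nth F n)" by (simp add: kz_grade_scaleC)
lift_definition times_kz_cuea :: "kz_cuea \<Rightarrow> kz_cuea \<Rightarrow> kz_cuea" is "(*)"
  by (simp add: kz_grade_fps_mult)

instance
proof
  fix u v w :: kz_cuea and a b :: complex
  show "u + v + w = u + (v + w)" by transfer (rule add.assoc)
  show "u + v = v + u" by transfer (rule add.commute)
  show "0 + u = u" by transfer (rule add_0)
  show "- u + u = 0" by transfer (rule left_minus)
  show "u - v = u + - v" by transfer (rule diff_conv_add_uminus)
  show "u * v * w = u * (v * w)" by transfer (rule mult.assoc)
  show "(u + v) * w = u * w + v * w" by transfer (rule distrib_right)
  show "u * (v + w) = u * v + u * w" by transfer (rule distrib_left)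
  show "1 * u = u" by transfer (rule mult_1_left)
  show "u * 1 = u" by transfer (rule mult_1_right)
  show "(0 :: kz_cuea) \<noteq> 1" by transfer (rule zero_neq_one)
  show "a *\<^sub>C (u + v) = a *\<^sub>C u + a *\<^sub>C v"
    by transfer (simp add: fps_eq_iff scaleC_add_right)
  show "(a + b) *\<^sub>C u = a *\<^sub>C u + b *\<^sub>C u"
    by transfer (simp add: fps_eq_iff scaleC_add_left)
  show "a *\<^sub>C b *\<^sub>C u = (a * b) *\<^sub>C u"
    by transfer (simp add: fps_eq_iff scaleC_scaleC)
  show "1 *\<^sub>C u = u"
    by transfer (simp add: fps_eq_iff scaleC_one)
  show "(a *\<^sub>C u) * v = a *\<^sub>C (u * v)"
    by transfer (simp add: fps_eq_iff fps_mult_nth mult_scaleC_left complex_vector.scale_sum_right)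
  show "u * (a *\<^sub>C v) = a *\<^sub>C (u * v)"
    by transfer (simp add: fps_eq_iff fps_mult_nth mult_scaleC_right complex_vector.scale_sum_right)
qed

end

definition component :: "nat \<Rightarrow> kz_cuea \<Rightarrow> kz_lie uea" where
  "component n u = fps_nth (Rep_kz_cuea u) n"

lift_definition kz_X :: "kz_gen \<Rightarrow> kz_cuea" is "\<lambda>g. fps_const (uea_in (kz_lie_gen g)) * fps_X"
  by (auto simp: fps_X_def kz_grade_gen kz_grade_zero)

lemma component_in_kz_grade: "component n u \<in> kz_grade n"
  using Rep_kz_cuea[of u] by (simp add: component_def)

lemma component_kz_X: "component n (kz_X g) = (if n = 1 then uea_in (kz_lie_gen g) else 0)"
  by (simp add: component_def kz_X.rep_eq fps_X_def)

lemma component_one: "component n 1 = (if n = 0 then 1 else 0)"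
  by (simp add: component_def one_kz_cuea.rep_eq)

lemma component_mult: "component n (u * v) = (\<Sum>i=0..n. component i u * component (n - i) v)"
  by (simp add: component_def times_kz_cuea.rep_eq fps_mult_nth)

lemma kz_cuea_eqI: "(\<And>n. component n u = component n v) \<Longrightarrow> u = v"
  by (simp add: component_def fps_eq_iff flip: Rep_kz_cuea_inject)

text \<open>The exponential series, used for elements \<open>u\<close> without constant term; then \<open>u ^ k\<close> has no
  component in degrees below \<open>k\<close>, and the sum below is the full exponential series.\<close>

lift_definition kz_exp :: "kz_cuea \<Rightarrow> kz_cuea"
  is "\<lambda>F. Abs_fps (\<lambda>n. \<Sum>k\<le>n. (1 / fact k) *\<^sub>C fps_nth (F ^ k) n)"
  by (auto intro!: kz_grade_sum kz_grade_scaleC kz_grade_fps_power)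

definition log_branch :: "complex set \<Rightarrow> (complex \<Rightarrow> complex) \<Rightarrow> bool" where
  "log_branch U l \<longleftrightarrow> open U \<and> l holomorphic_on U \<and> (\<forall>z\<in>U. exp (l z) = z)"

text \<open>The power \<open>z\<close> to the exponent \<open>X\<^sub>g\<close>, formed with the branch \<open>l\<close> of the logarithm.\<close>

definition kz_pow :: "(complex \<Rightarrow> complex) \<Rightarrow> complex \<Rightarrow> kz_gen \<Rightarrow> kz_cuea" where
  "kz_pow l z g = kz_exp (l z *\<^sub>C kz_X g)"

section \<open>Holomorphy and derivatives degree by degree\<close>

text \<open>Each homogeneous component is a finite-dimensional complex vector space (spanned by the
  finitely many words of length \<open>n\<close>), so holomorphy and derivatives of a function into it are
  tested by composing with the linear functionals.\<close>

definition holo1 :: "(complex \<Rightarrow> kz_cuea) \<Rightarrow> complex set \<Rightarrow> bool" where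
  "holo1 F D \<longleftrightarrow>
    (\<forall>n \<phi>. complex_functional \<phi> \<longrightarrow> (\<lambda>z. \<phi> (component n (F z))) holomorphic_on D)"

definition holomorphic2_on :: "(complex \<times> complex \<Rightarrow> complex) \<Rightarrow> (complex \<times> complex) set \<Rightarrow> bool" where
  "holomorphic2_on f D \<longleftrightarrow>
    (\<forall>z\<in>D. \<exists>a b. (f has_derivative (\<lambda>h. a * fst h + b * snd h)) (at z within D))"

definition holo2 :: "(complex \<times> complex \<Rightarrow> kz_cuea) \<Rightarrow> (complex \<times> complex) set \<Rightarrow> bool" where
  "holo2 F D \<longleftrightarrow>
    (\<forall>n \<phi>. complex_functional \<phi> \<longrightarrow> holomorphic2_on (\<lambda>z. \<phi> (component n (F z))) D)"

definition has_deriv1 :: "(complex \<Rightarrow> kz_cuea) \<Rightarrow> kz_cuea \<Rightarrow> complex \<Rightarrow> bool" where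
  "has_deriv1 F d z \<longleftrightarrow>
    (\<forall>n \<phi>. complex_functional \<phi> \<longrightarrow>
      ((\<lambda>w. \<phi> (component n (F w))) has_field_derivative \<phi> (component n d)) (at z))"

definition has_differential2 ::
  "(complex \<times> complex \<Rightarrow> kz_cuea) \<Rightarrow> (complex \<times> complex \<Rightarrow> kz_cuea) \<Rightarrow> complex \<times> complex \<Rightarrow> bool" where
  "has_differential2 F dF z \<longleftrightarrow>
    (\<forall>n \<phi>. complex_functional \<phi> \<longrightarrow>
      ((\<lambda>w. \<phi> (component n (F w))) has_derivative (\<lambda>h. \<phi> (component n (dF h)))) (at z))"

section \<open>The equations and their normalized fundamental solutions\<close>

text \<open>The value of the connection form at the point \<open>z\<close> on the tangent vector \<open>h = (dz\<^sub>1, dz\<^sub>2)\<close>.\<close>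

definition kz_form :: "complex \<times> complex \<Rightarrow> complex \<times> complex \<Rightarrow> kz_cuea" where
  "kz_form z h =
     (fst h / fst z) *\<^sub>C kz_X X1
   + (fst h / (1 - fst z)) *\<^sub>C kz_X X11
   + (snd h / snd z) *\<^sub>C kz_X X2
   + (snd h / (1 - snd z)) *\<^sub>C kz_X X22
   + ((fst h * snd z + fst z * snd h) / (1 - fst z * snd z)) *\<^sub>C kz_X X12"

definition kz_sol ::
  "(complex \<Rightarrow> complex) \<Rightarrow> (complex \<Rightarrow> complex) \<Rightarrow> (complex \<times> complex \<Rightarrow> kz_cuea) \<Rightarrow> complex \<times> complex \<Rightarrow> kz_cuea" where
  "kz_sol l1 l2 Lh z = Lh z * kz_pow l1 (fst z) X1 * kz_pow l2 (snd z) X2"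

text \<open>\<open>Lh\<close> is the holomorphic part, on the neighbourhood \<open>D\<close> of the origin, of the fundamental
  solution \<open>kz_sol l1 l2 Lh\<close> normalized at the origin; \<open>U\<close> is a part of \<open>D\<close> on which the chosen
  branches \<open>l1\<close>, \<open>l2\<close> of the logarithms are defined.\<close>

definition kz_fundamental ::
  "(complex \<times> complex) set \<Rightarrow> (complex \<times> complex) set \<Rightarrow> (complex \<Rightarrow> complex) \<Rightarrow> (complex \<Rightarrow> complex) \<Rightarrow>
    (complex \<times> complex \<Rightarrow> kz_cuea) \<Rightarrow> bool" where
  "kz_fundamental D U l1 l2 Lh \<longleftrightarrow>
     holo2 Lh D \<and> Lh (0, 0) = 1 \<and>
     (\<forall>z\<in>U. has_differential2 (kz_sol l1 l2 Lh) (\<lambda>h. kz_form z h * kz_sol l1 l2 Lh z) z)"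

definition ode_sol :: "(complex \<Rightarrow> complex) \<Rightarrow> kz_gen \<Rightarrow> (complex \<Rightarrow> kz_cuea) \<Rightarrow> complex \<Rightarrow> kz_cuea" where
  "ode_sol l g Lh z = Lh z * kz_pow l z g"

text \<open>The same for the ordinary differential equation \<open>dG/dz = A(z) G\<close> and solutions of the form
  \<open>Lh(z)\<close> times the power of \<open>z\<close> to the exponent \<open>X\<^sub>g\<close>, normalized at \<open>z = 0\<close>.\<close>

definition ode_fundamental ::
  "complex set \<Rightarrow> complex set \<Rightarrow> (complex \<Rightarrow> complex) \<Rightarrow> kz_gen \<Rightarrow> (complex \<Rightarrow> kz_cuea) \<Rightarrow>
    (complex \<Rightarrow> kz_cuea) \<Rightarrow> bool" where
  "ode_fundamental D U l g A Lh \<longleftrightarrow>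
     holo1 Lh D \<and> Lh 0 = 1 \<and>
     (\<forall>z\<in>U. has_deriv1 (ode_sol l g Lh) (A z * ode_sol l g Lh z) z)"

definition coeff1 :: "kz_gen \<Rightarrow> kz_gen \<Rightarrow> complex \<Rightarrow> kz_cuea" where
  "coeff1 g gg z = (1 / z) *\<^sub>C kz_X g + (1 / (1 - z)) *\<^sub>C kz_X gg"

definition coeff2 :: "kz_gen \<Rightarrow> kz_gen \<Rightarrow> complex \<Rightarrow> complex \<Rightarrow> kz_cuea" where
  "coeff2 g gg w z =
     (1 / z) *\<^sub>C kz_X g + (1 / (1 - z)) *\<^sub>C kz_X gg + (w / (1 - w * z)) *\<^sub>C kz_X X12"

end

theory Submission
  imports Defs
begin

text \<open>Write the solution as \<open>L z\<^sub>1\<^bsup>X\<^sub>1\<^esup> z\<^sub>2\<^bsup>X\<^sub>2\<^esup>\<close> with \<open>L\<close> holomorphic. Removing the powers of \<open>z\<^sub>1\<close> and \<open>z\<^sub>2\<close>,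
  which commute because \<open>[X\<^sub>1, X\<^sub>2] = 0\<close>, turns the system into two regularized equations
  \<open>z\<^sub>i \<partial>\<^sub>iL = [X\<^sub>i, L] + z\<^sub>i (X\<^sub>i\<^sub>i/(1 - z\<^sub>i) + z\<^sub>j X\<^sub>1\<^sub>2/(1 - z\<^sub>1z\<^sub>2)) L\<close>. They hold where the logarithms are
  defined, and by the identity theorem on the whole polydomain (\<open>kz_fundamental_kz_regular\<close>).
  The continuation in the parameter variable uses that a partial derivative of a holomorphic
  function is holomorphic in the other variable (\<open>holomorphic2_on_partial_deriv\<close>).

  Put \<open>P(z\<^sub>1) = L(z\<^sub>1, 0)\<close>. The first equation at \<open>z\<^sub>2 = 0\<close> is the one-variable equation for \<open>P\<close>, and the
  second one at \<open>z\<^sub>2 = 0\<close> says \<open>[X\<^sub>2, P] = 0\<close>. Since \<open>P\<close> has constant term \<open>1\<close> it is invertible, and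
  since it commutes with \<open>X\<^sub>2\<close> the quotient \<open>Q = L P\<^sup>-\<^sup>1\<close> again solves the second equation, with
  \<open>Q(z\<^sub>1, 0) = 1\<close>. So \<open>L = Q P\<close>, and moving \<open>P\<close> past \<open>z\<^sub>2\<^bsup>X\<^sub>2\<^esup>\<close> gives the factorization of the
  solution itself (\<open>decomposition\<close>). Normalized solutions of the regularized equations are unique
  (\<open>kz_regular_unique\<close>): the right-hand side raises the degree, so the difference of two of them
  vanishes degree by degree. The second decomposition is the first with the variables exchanged.

  All analysis is scalar: functions with values in the completion are tested by functionals on
  their components, and products are handled by expanding one factor in a finite basis of a
  homogeneous component (\<open>functional_component_mult\<close>).\<close>

section \<open>Linear functionals on the homogeneous components\<close>

lemma complex_functional_iff:
  "complex_functional \<phi> \<longleftrightarrow>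
    (\<forall>u v. \<phi> (u + v) = \<phi> u + \<phi> v) \<and> (\<forall>a u. \<phi> (a *\<^sub>C u) = a * \<phi> u)"
proof -
  have "vector_space ((*) :: complex \<Rightarrow> complex \<Rightarrow> complex)"
    by unfold_locales (auto simp: algebra_simps)
  then show ?thesis
    by (simp add: Vector_Spaces.linear_iff complex_vector.vector_space_axioms)
qed

lemma
  assumes "complex_functional \<phi>"
  shows functional_add: "\<phi> (u + v) = \<phi> u + \<phi> v"
    and functional_diff: "\<phi> (u - v) = \<phi> u - \<phi> v"
    and functional_scaleC: "\<phi> (a *\<^sub>C u) = a * \<phi> u"
    and functional_zero: "\<phi> 0 = 0"
    and functional_sum: "\<phi> (sum f A) = (\<Sum>i\<in>A. \<phi> (f i))"
proof -
  interpret Vector_Spaces.linear scaleC "(*)" \<phi> by (fact assms)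
  show "\<phi> (u + v) = \<phi> u + \<phi> v" "\<phi> (u - v) = \<phi> u - \<phi> v" "\<phi> (a *\<^sub>C u) = a * \<phi> u"
    "\<phi> 0 = 0" "\<phi> (sum f A) = (\<Sum>i\<in>A. \<phi> (f i))"
    by (rule add diff scale zero sum)+
qed

lemma functional_mult_left:
  fixes x :: "'a::complex_algebra_1"
  assumes "complex_functional \<phi>"
  shows "complex_functional (\<lambda>u. \<phi> (x * u))"
  using assms unfolding complex_functional_iff by (simp add: distrib_left mult_scaleC_right)

lemma functional_mult_right:
  fixes x :: "'a::complex_algebra_1"
  assumes "complex_functional \<phi>"
  shows "complex_functional (\<lambda>u. \<phi> (u * x))"
  using assms unfolding complex_functional_iff by (simp add: distrib_right mult_scaleC_left)

text \<open>The words of length \<open>n\<close> are finitely many, so a basis of their span is finite, and its coordinate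
  functions extend to functionals on the whole enveloping algebra. Such
  coordinates make scalar calculus applicable to products of two varying factors.\<close>

lemma kz_grade_coordinates:
  "\<exists>B \<psi>. finite B \<and> (\<forall>b\<in>B. complex_functional (\<psi> b)) \<and>
    (\<forall>u\<in>kz_grade n. u = (\<Sum>b\<in>B. \<psi> b u *\<^sub>C b))"
proof -
  interpret vector_space_pair "scaleC :: complex \<Rightarrow> kz_lie uea \<Rightarrow> kz_lie uea"
      "(*) :: complex \<Rightarrow> complex \<Rightarrow> complex"
    by unfold_locales (auto simp: algebra_simps)
  let ?W = "kz_word ` {ws. length ws = n}"
  have "(UNIV :: kz_gen set) = {X1, X11, X2, X22, X12}"
    using kz_gen.exhaust by blast
  then have "finite (UNIV :: kz_gen set)" by (metis finite.emptyI finite_insert)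
  then have "finite ?W" using finite_lists_length_eq[of "UNIV :: kz_gen set" n] by simp
  obtain B where B: "B \<subseteq> ?W" "complex_vector.independent B" "?W \<subseteq> complex_vector.span B"
    by (rule complex_vector.maximal_independent_subset)
  have "finite B" using B(1) \<open>finite ?W\<close> by (rule finite_subset)
  have "\<exists>\<psi>. complex_functional \<psi> \<and> (\<forall>x\<in>B. \<psi> x = (if x = b then 1 else 0))" for b
    using linear_independent_extend[OF B(2)] .
  then obtain \<psi> where \<psi>: "\<And>b. complex_functional (\<psi> b)"
      "\<And>b x. x \<in> B \<Longrightarrow> \<psi> b x = (if x = b then 1 else 0)"
    by metis
  have "u = (\<Sum>b\<in>B. \<psi> b u *\<^sub>C b)" if "u \<in> kz_grade n" for u
  proof -
    have "u \<in> complex_vector.span B"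
      using that complex_vector.span_minimal[OF B(3)] by (auto simp: kz_grade_def)
    then show ?thesis
    proof (induction u rule: complex_vector.span_induct_alt)
      case base
      then show ?case by (simp add: functional_zero[OF \<psi>(1)])
    next
      case (step c x y)
      have "(\<Sum>b\<in>B. \<psi> b x *\<^sub>C b) = (\<Sum>b\<in>B. if b = x then x else 0)"
        using step(1) by (intro sum.cong) (auto simp: \<psi>(2) scaleC_one)
      also have "\<dots> = x" using step(1) \<open>finite B\<close> by simp
      finally show ?case
        using step(2) by (simp add: functional_add[OF \<psi>(1)] functional_scaleC[OF \<psi>(1)]
          scaleC_add_left sum.distrib flip: scaleC_scaleC complex_vector.scale_sum_right)
    qed
  qed
  with \<open>finite B\<close> \<psi>(1) show ?thesis by blast
qed

lemma functional_eqI: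
  assumes "u \<in> kz_grade n" "v \<in> kz_grade n"
    and "\<And>\<phi>. complex_functional \<phi> \<Longrightarrow> \<phi> u = \<phi> v"
  shows "u = v"
proof -
  obtain B \<psi> where B: "\<forall>b\<in>B. complex_functional (\<psi> b)"
    "\<forall>u\<in>kz_grade n. u = (\<Sum>b\<in>B. \<psi> b u *\<^sub>C b)"
    using kz_grade_coordinates[of n] by blast
  have "u = (\<Sum>b\<in>B. \<psi> b u *\<^sub>C b)" "v = (\<Sum>b\<in>B. \<psi> b v *\<^sub>C b)"
    using B(2) assms(1,2) by blast+
  moreover have "(\<Sum>b\<in>B. \<psi> b u *\<^sub>C b) = (\<Sum>b\<in>B. \<psi> b v *\<^sub>C b)"
    using assms(3) B(1) by (intro sum.cong) auto
  ultimately show ?thesis by simp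
qed

lemma component_eqI:
  assumes "\<And>\<phi>. complex_functional \<phi> \<Longrightarrow> \<phi> (component n u) = \<phi> (component n v)"
  shows "component n u = component n v"
  using component_in_kz_grade component_in_kz_grade assms by (rule functional_eqI)

text \<open>A functional of a product is a finite sum of products of scalar functions of the two factors: the
  left factor is expanded in coordinates, and the basis element is absorbed into the functional.
  The product rules below reduce to the scalar ones through this formula.\<close>

lemma functional_component_mult:
  assumes "complex_functional \<phi>"
  shows "\<exists>B \<psi>. (\<forall>i. \<forall>b\<in>B i. complex_functional (\<psi> i b)) \<and>
    (\<forall>u v. \<phi> (component n (u * v)) =
      (\<Sum>i=0..n. \<Sum>b\<in>B i. \<psi> i b (component i u) * \<phi> (b * component (n - i) v)))"
proof -
  have "\<forall>i. \<exists>B \<psi>. finite B \<and> (\<forall>b\<in>B. complex_functional (\<psi> b)) \<and>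
      (\<forall>u\<in>kz_grade i. u = (\<Sum>b\<in>B. \<psi> b u *\<^sub>C b))"
    by (intro allI kz_grade_coordinates)
  from choice[OF this] obtain B where "\<forall>i. \<exists>\<psi>. finite (B i) \<and>
      (\<forall>b\<in>B i. complex_functional (\<psi> b)) \<and> (\<forall>u\<in>kz_grade i. u = (\<Sum>b\<in>B i. \<psi> b u *\<^sub>C b))" ..
  from choice[OF this] obtain \<psi> where B: "\<forall>i. finite (B i) \<and>
      (\<forall>b\<in>B i. complex_functional (\<psi> i b)) \<and> (\<forall>u\<in>kz_grade i. u = (\<Sum>b\<in>B i. \<psi> i b u *\<^sub>C b))" ..
  have "\<phi> (component n (u * v)) =
      (\<Sum>i=0..n. \<Sum>b\<in>B i. \<psi> i b (component i u) * \<phi> (b * component (n - i) v))" for u v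
  proof -
    have "component i u * x = (\<Sum>b\<in>B i. \<psi> i b (component i u) *\<^sub>C (b * x))" for i x
    proof -
      have "component i u = (\<Sum>b\<in>B i. \<psi> i b (component i u) *\<^sub>C b)"
        using B component_in_kz_grade by blast
      then have "component i u * x = (\<Sum>b\<in>B i. \<psi> i b (component i u) *\<^sub>C b) * x" by simp
      then show ?thesis by (simp add: sum_distrib_right mult_scaleC_left)
    qed
    then show ?thesis
      by (simp add: component_mult functional_sum[OF assms] functional_scaleC[OF assms])
  qed
  with B show ?thesis by blast
qed

section \<open>Calculus with values in the completion\<close>

lemma
  shows component_zero: "component n 0 = 0"
    and component_add: "component n (u + v) = component n u + component n v"
    and component_diff: "component n (u - v) = component n u - component n v"
    and component_scaleC: "component n (a *\<^sub>C u) = a *\<^sub>C component n u"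
  by (simp_all add: component_def zero_kz_cuea.rep_eq plus_kz_cuea.rep_eq minus_kz_cuea.rep_eq
      scaleC_kz_cuea.rep_eq)

lemma component_sum: "component n (sum f A) = (\<Sum>i\<in>A. component n (f i))"
  by (induction A rule: infinite_finite_induct) (auto simp: component_zero component_add)

lemma component_X_mult:
  "component n (kz_X g * u) = (if n = 0 then 0 else uea_in (kz_lie_gen g) * component (n - 1) u)"
proof -
  have "component n (kz_X g * u) =
      (\<Sum>i=0..n. if i = 1 then uea_in (kz_lie_gen g) * component (n - 1) u else 0)"
    unfolding component_mult by (intro sum.cong) (auto simp: component_kz_X)
  then show ?thesis by simp
qed

lemma component_mult_X:
  "component n (u * kz_X g) = (if n = 0 then 0 else component (n - 1) u * uea_in (kz_lie_gen g))"
proof -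
  have "component n (u * kz_X g) =
      (\<Sum>i=0..n. if i = n - 1 \<and> n \<noteq> 0 then component (n - 1) u * uea_in (kz_lie_gen g) else 0)"
    unfolding component_mult by (intro sum.cong) (auto simp: component_kz_X)
  then show ?thesis by (cases "n = 0") simp_all
qed

lemma holo1_mult:
  assumes "holo1 F D" "holo1 G D"
  shows "holo1 (\<lambda>z. F z * G z) D"
  unfolding holo1_def
proof (intro allI impI)
  fix n and \<phi> :: "kz_lie uea \<Rightarrow> complex" assume \<phi>: "complex_functional \<phi>"
  obtain B \<psi> where B: "\<forall>i. \<forall>b\<in>B i. complex_functional (\<psi> i b)"
    and expand: "\<forall>u v. \<phi> (component n (u * v)) =
      (\<Sum>i=0..n. \<Sum>b\<in>B i. \<psi> i b (component i u) * \<phi> (b * component (n - i) v))"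
    using functional_component_mult[OF \<phi>, of n] by blast
  have "(\<lambda>z. \<psi> i b (component i (F z))) holomorphic_on D" if "b \<in> B i" for i b
    using assms(1) B that unfolding holo1_def by blast
  moreover have "(\<lambda>z. \<phi> (b * component m (G z))) holomorphic_on D" for b m
    using assms(2) functional_mult_left[OF \<phi>, of b] unfolding holo1_def by blast
  ultimately show "(\<lambda>z. \<phi> (component n (F z * G z))) holomorphic_on D"
    unfolding expand[rule_format]
    by (intro holomorphic_on_sum holomorphic_on_mult)
qed

lemma holo1_const: "holo1 (\<lambda>z. u) D"
  by (simp add: holo1_def)

lemma holo1_diff: "holo1 F D \<Longrightarrow> holo1 G D \<Longrightarrow> holo1 (\<lambda>z. F z - G z) D"
  unfolding holo1_def
  by (auto simp: component_diff functional_diff intro!: holomorphic_on_diff)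

lemma has_deriv1_mult:
  assumes "has_deriv1 F d z" "has_deriv1 G e z"
  shows "has_deriv1 (\<lambda>z. F z * G z) (d * G z + F z * e) z"
  unfolding has_deriv1_def
proof (intro allI impI)
  fix n and \<phi> :: "kz_lie uea \<Rightarrow> complex" assume \<phi>: "complex_functional \<phi>"
  obtain B \<psi> where B: "\<forall>i. \<forall>b\<in>B i. complex_functional (\<psi> i b)"
    and expand: "\<forall>u v. \<phi> (component n (u * v)) =
      (\<Sum>i=0..n. \<Sum>b\<in>B i. \<psi> i b (component i u) * \<phi> (b * component (n - i) v))"
    using functional_component_mult[OF \<phi>, of n] by blast
  have "((\<lambda>z. \<psi> i b (component i (F z)) * \<phi> (b * component (n - i) (G z))) has_field_derivative
      (\<psi> i b (component i d) * \<phi> (b * component (n - i) (G z)) +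
       \<psi> i b (component i (F z)) * \<phi> (b * component (n - i) e))) (at z)"
    if "i \<in> {0..n}" "b \<in> B i" for i b
  proof -
    have 1: "((\<lambda>z. \<psi> i b (component i (F z))) has_field_derivative \<psi> i b (component i d)) (at z)"
      using assms(1) B that unfolding has_deriv1_def by auto
    have 2: "((\<lambda>z. \<phi> (b * component (n - i) (G z))) has_field_derivative
        \<phi> (b * component (n - i) e)) (at z)"
      using assms(2) functional_mult_left[OF \<phi>, of b] unfolding has_deriv1_def by blast
    show ?thesis using DERIV_mult[OF 1 2] by (simp add: algebra_simps)
  qed
  then show "((\<lambda>z. \<phi> (component n (F z * G z))) has_field_derivative
      \<phi> (component n (d * G z + F z * e))) (at z)"
    unfolding component_add functional_add[OF \<phi>] expand[rule_format] sum.distrib[symmetric]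
    by (intro DERIV_sum)
qed

lemma has_deriv1_const: "has_deriv1 (\<lambda>z. u) 0 z"
  by (auto simp: has_deriv1_def component_zero functional_zero)

lemma has_deriv1_mult_const: "has_deriv1 F d z \<Longrightarrow> has_deriv1 (\<lambda>z. F z * u) (d * u) z"
  using has_deriv1_mult[OF _ has_deriv1_const] by simp

section \<open>Inverses and powers\<close>

text \<open>The Neumann series \<open>1 + u + u\<^sup>2 + \<dots>\<close> for \<open>u\<close> without constant term, truncated in degree \<open>n\<close> after
  the terms that contribute to it.\<close>

lift_definition kz_neumann :: "kz_cuea \<Rightarrow> kz_cuea"
  is "\<lambda>F. Abs_fps (\<lambda>n. \<Sum>k\<le>n. fps_nth (F ^ k) n)"
  by (auto intro!: kz_grade_sum kz_grade_fps_power)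

lemma power_rep_eq: "Rep_kz_cuea (u ^ k) = Rep_kz_cuea u ^ k"
  by (induction k) (simp_all add: one_kz_cuea.rep_eq times_kz_cuea.rep_eq)

lemma component_power_below:
  assumes "component 0 u = 0" "n < k"
  shows "component n (u ^ k) = 0"
  using assms(2)
proof (induction k arbitrary: n)
  case (Suc k)
  have "component i u * component (n - i) (u ^ k) = 0" if "i \<in> {0..n}" for i
  proof (cases "i = 0")
    case False
    then show ?thesis using Suc that by simp
  qed (simp add: assms(1))
  then show ?case by (simp add: component_mult del: mult_eq_0_iff)
qed simp

lemma component_kz_neumann:
  assumes "component 0 u = 0" "n \<le> N"
  shows "component n (kz_neumann u) = component n (\<Sum>k\<le>N. u ^ k)"
proof -
  have "component n (kz_neumann u) = (\<Sum>k\<le>n. component n (u ^ k))"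
    by (simp add: component_def kz_neumann.rep_eq power_rep_eq)
  also have "\<dots> = (\<Sum>k\<le>N. component n (u ^ k))"
    using assms by (intro sum.mono_neutral_left) (auto simp: component_power_below)
  finally show ?thesis by (simp add: component_sum)
qed

lemma kz_neumann_inverse:
  assumes "component 0 u = 1"
  shows "kz_neumann (1 - u) * u = 1" "u * kz_neumann (1 - u) = 1"
proof -
  let ?v = "1 - u"
  have v: "component 0 ?v = 0" using assms by (simp add: component_diff component_one)
  have geometric: "(\<Sum>k\<le>n. w ^ k) * (1 - w) = 1 - w ^ Suc n" "(1 - w) * (\<Sum>k\<le>n. w ^ k) = 1 - w ^ Suc n"
    for n and w :: kz_cuea
  proof (induction n)
    case (Suc n)
    { case 1 show ?case using Suc(1)
        by (simp add: distrib_right right_diff_distrib power_Suc2 add_diff_eq[symmetric] del: power_Suc)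
          (simp add: algebra_simps) }
    { case 2 show ?case using Suc(2)
        by (simp add: distrib_left left_diff_distrib power_Suc[of _ "Suc n"] del: power_Suc) }
  qed simp_all
  have *: "(\<Sum>k\<le>n. ?v ^ k) * u = 1 - ?v ^ Suc n" "u * (\<Sum>k\<le>n. ?v ^ k) = 1 - ?v ^ Suc n" for n
    using geometric[of ?v n] by simp_all
  show "kz_neumann ?v * u = 1"
  proof (rule kz_cuea_eqI)
    fix n
    have "component n (kz_neumann ?v * u) = component n ((\<Sum>k\<le>n. ?v ^ k) * u)"
      unfolding component_mult by (intro sum.cong) (auto simp: component_kz_neumann[OF v])
    then show "component n (kz_neumann ?v * u) = component n 1"
      using component_power_below[OF v, of n "Suc n"] by (simp add: * component_diff del: power_Suc)
  qed
  show "u * kz_neumann ?v = 1"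
  proof (rule kz_cuea_eqI)
    fix n
    have "component n (u * kz_neumann ?v) = component n (u * (\<Sum>k\<le>n. ?v ^ k))"
      unfolding component_mult
      by (intro sum.cong) (auto simp: component_kz_neumann[OF v, of _ n])
    then show "component n (u * kz_neumann ?v) = component n 1"
      using component_power_below[OF v, of n "Suc n"] by (simp add: * component_diff del: power_Suc)
  qed
qed

lemma component_kz_exp_X:
  "component n (kz_exp (c *\<^sub>C kz_X g)) = (c ^ n / fact n) *\<^sub>C uea_in (kz_lie_gen g) ^ n"
proof -
  have pow: "component m ((c *\<^sub>C kz_X g) ^ k) = (if m = k then c ^ k *\<^sub>C uea_in (kz_lie_gen g) ^ k else 0)"
    for m k
    by (induction k arbitrary: m)
      (auto simp: component_one scaleC_one mult_scaleC_left mult_scaleC_right component_scaleC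
        component_X_mult scaleC_scaleC complex_vector.scale_zero_right)
  have "component n (kz_exp (c *\<^sub>C kz_X g)) = (\<Sum>k\<le>n. (1 / fact k) *\<^sub>C component n ((c *\<^sub>C kz_X g) ^ k))"
    by (simp add: component_def kz_exp.rep_eq power_rep_eq)
  also have "\<dots> = (\<Sum>k\<le>n. if k = n then (c ^ n / fact n) *\<^sub>C uea_in (kz_lie_gen g) ^ n else 0)"
    by (intro sum.cong) (auto simp: pow scaleC_scaleC complex_vector.scale_zero_right)
  finally show ?thesis by simp
qed

lemma kz_exp_X_commute:
  assumes "u * kz_X g = kz_X g * u"
  shows "u * kz_exp (c *\<^sub>C kz_X g) = kz_exp (c *\<^sub>C kz_X g) * u"
proof (rule kz_cuea_eqI)
  fix n
  let ?x = "uea_in (kz_lie_gen g)"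
  have "component m u * ?x = ?x * component m u" for m
    using arg_cong[OF assms, of "component (Suc m)"] by (simp add: component_X_mult component_mult_X)
  then have comm: "component m u * ?x ^ k = ?x ^ k * component m u" for m k
    by (metis power_commuting_commutes)
  have "component n (u * kz_exp (c *\<^sub>C kz_X g)) =
      (\<Sum>i=0..n. component (n - i) u * component i (kz_exp (c *\<^sub>C kz_X g)))"
    unfolding component_mult by (subst sum.atLeastAtMost_rev) simp
  also have "\<dots> = component n (kz_exp (c *\<^sub>C kz_X g) * u)"
    unfolding component_mult component_kz_exp_X mult_scaleC_left mult_scaleC_right comm ..
  finally show "component n (u * kz_exp (c *\<^sub>C kz_X g)) = component n (kz_exp (c *\<^sub>C kz_X g) * u)" .
qed

lemma kz_exp_X_add:
  "kz_exp (a *\<^sub>C kz_X g) * kz_exp (b *\<^sub>C kz_X g) = kz_exp ((a + b) *\<^sub>C kz_X g)"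
proof (rule kz_cuea_eqI)
  fix n
  let ?x = "uea_in (kz_lie_gen g)"
  have "component n (kz_exp (a *\<^sub>C kz_X g) * kz_exp (b *\<^sub>C kz_X g)) =
     (\<Sum>i=0..n. ((1 / fact n) * (of_nat (n choose i) * a ^ i * b ^ (n - i))) *\<^sub>C ?x ^ n)"
    unfolding component_mult
    by (intro sum.cong) (auto simp: component_kz_exp_X mult_scaleC_left mult_scaleC_right scaleC_scaleC
        binomial_fact mult.commute simp flip: power_add)
  also have "\<dots> = ((1 / fact n) * (a + b) ^ n) *\<^sub>C ?x ^ n"
    unfolding binomial_ring sum_distrib_left complex_vector.scale_sum_left atLeast0AtMost ..
  finally show "component n (kz_exp (a *\<^sub>C kz_X g) * kz_exp (b *\<^sub>C kz_X g)) =
      component n (kz_exp ((a + b) *\<^sub>C kz_X g))"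
    by (simp add: component_kz_exp_X)
qed

lemma kz_exp_0: "kz_exp (0 *\<^sub>C kz_X g) = 1"
proof (rule kz_cuea_eqI)
  show "component n (kz_exp (0 *\<^sub>C kz_X g)) = component n 1" for n
    unfolding component_kz_exp_X component_one by (simp add: power_0_left scaleC_one)
qed

text \<open>In each degree the exponential is a scalar monomial in \<open>f z\<close> times a fixed power of the generator,
  so the derivative is taken coefficient by coefficient.\<close>

lemma has_deriv1_kz_exp:
  assumes "(f has_field_derivative d) (at z)"
  shows "has_deriv1 (\<lambda>z. kz_exp (f z *\<^sub>C kz_X g)) (d *\<^sub>C (kz_X g * kz_exp (f z *\<^sub>C kz_X g))) z"
  unfolding has_deriv1_def
proof (intro allI impI)
  fix n and \<phi> :: "kz_lie uea \<Rightarrow> complex" assume \<phi>: "complex_functional \<phi>"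
  let ?x = "uea_in (kz_lie_gen g)"
  have *: "((\<lambda>w. f w ^ n / fact n * \<phi> (?x ^ n)) has_field_derivative
      (of_nat n * f z ^ (n - 1) * d) / fact n * \<phi> (?x ^ n)) (at z)"
    using assms by (auto intro!: derivative_eq_intros)
  have "(of_nat n * f z ^ (n - 1) * d) / fact n * \<phi> (?x ^ n) =
      \<phi> (component n (d *\<^sub>C (kz_X g * kz_exp (f z *\<^sub>C kz_X g))))"
    by (cases n) (simp_all add: component_scaleC component_X_mult component_kz_exp_X functional_zero[OF \<phi>]
        functional_scaleC[OF \<phi>] mult_scaleC_right scaleC_scaleC field_simps del: of_nat_Suc)
  with * show "((\<lambda>w. \<phi> (component n (kz_exp (f w *\<^sub>C kz_X g)))) has_field_derivative
      \<phi> (component n (d *\<^sub>C (kz_X g * kz_exp (f z *\<^sub>C kz_X g))))) (at z)"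
    by (simp add: component_kz_exp_X functional_scaleC[OF \<phi>])
qed

section \<open>Holomorphic functions of two variables\<close>

lemma holomorphic2_on_swap:
  assumes "holomorphic2_on f (A \<times> B)"
  shows "holomorphic2_on (\<lambda>z. f (snd z, fst z)) (B \<times> A)"
  unfolding holomorphic2_on_def
proof
  fix z assume z: "z \<in> B \<times> A"
  with assms obtain c d
    where "(f has_derivative (\<lambda>h. c * fst h + d * snd h)) (at (snd z, fst z) within A \<times> B)"
    unfolding holomorphic2_on_def by force
  then have "(f has_derivative (\<lambda>h. c * fst h + d * snd h)) (at (snd z, fst z) within (\<lambda>z. (snd z, fst z)) ` (B \<times> A))"
    by (rule has_derivative_subset) auto
  moreover have "((\<lambda>z. (snd z, fst z)) has_derivative (\<lambda>h. (snd h, fst h))) (at z within B \<times> A)"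
    by (auto intro!: derivative_eq_intros)
  ultimately have "((f \<circ> (\<lambda>z. (snd z, fst z))) has_derivative
      (\<lambda>h. c * fst h + d * snd h) \<circ> (\<lambda>h. (snd h, fst h))) (at z within B \<times> A)"
    by (intro diff_chain_within)
  then show "\<exists>a b. ((\<lambda>z. f (snd z, fst z)) has_derivative (\<lambda>h. a * fst h + b * snd h)) (at z within B \<times> A)"
    by (intro exI[of _ d] exI[of _ c]) (simp add: o_def add.commute)
qed

lemma holomorphic2_on_slices:
  assumes "holomorphic2_on f (A \<times> B)"
  shows "b \<in> B \<Longrightarrow> (\<lambda>a. f (a, b)) holomorphic_on A"
    and "a \<in> A \<Longrightarrow> (\<lambda>b. f (a, b)) holomorphic_on B"
proof -
  have slice: "(\<lambda>a. f (a, b)) holomorphic_on A" if f: "holomorphic2_on f (A \<times> B)" and b: "b \<in> B" for f A B b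
  proof (rule holomorphic_onI)
    fix a assume "a \<in> A"
    with f b obtain c d
      where "(f has_derivative (\<lambda>h. c * fst h + d * snd h)) (at (a, b) within A \<times> B)"
      unfolding holomorphic2_on_def by blast
    then have "(f has_derivative (\<lambda>h. c * fst h + d * snd h)) (at (a, b) within (\<lambda>a. (a, b)) ` A)"
      by (rule has_derivative_subset) (use b in auto)
    moreover have "((\<lambda>a. (a, b)) has_derivative (\<lambda>h. (h, 0))) (at a within A)"
      by (auto intro!: derivative_eq_intros)
    ultimately have "((f \<circ> (\<lambda>a. (a, b))) has_derivative
        (\<lambda>h. c * fst h + d * snd h) \<circ> (\<lambda>h. (h, 0))) (at a within A)"
      by (intro diff_chain_within)
    then show "(\<lambda>a. f (a, b)) field_differentiable at a within A"
      unfolding field_differentiable_def has_field_derivative_def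
      by (intro exI[of _ c]) (simp add: o_def)
  qed
  show "(\<lambda>a. f (a, b)) holomorphic_on A" if "b \<in> B"
    using slice[OF assms that] .
  show "(\<lambda>b. f (a, b)) holomorphic_on B" if "a \<in> A"
    using slice[OF holomorphic2_on_swap[OF assms] that] by simp
qed

lemma holomorphic2_on_imp_continuous_on: "holomorphic2_on f D \<Longrightarrow> continuous_on D f"
  unfolding holomorphic2_on_def continuous_on_eq_continuous_within
  by (blast intro: has_derivative_continuous)

text \<open>Taylor's formula, with the second derivative bounded by Cauchy's inequality on discs of radius
  \<open>r / 2\<close>. The constant depends on \<open>g\<close> only through its bound \<open>M\<close>, which gives uniformity
  in a parameter.\<close>

lemma difference_quotient_bound:
  fixes g :: "complex \<Rightarrow> complex"
  assumes "g holomorphic_on S" "open S" "cball a r \<subseteq> S" "0 < r"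
    and bound: "\<And>s. s \<in> cball a r \<Longrightarrow> norm (g s) \<le> M"
    and h: "h \<noteq> 0" "norm h \<le> r / 2"
  shows "norm ((g (a + h) - g a) / h - deriv g a) \<le> 8 * M / r\<^sup>2 * norm h"
proof -
  let ?C = "8 * M / r\<^sup>2"
  have sub: "cball s (r / 2) \<subseteq> cball a r" if "s \<in> cball a (r / 2)" for s
    using that by (simp add: cball_subset_cball_iff dist_commute)
  have "norm ((deriv ^^ 2) g s) \<le> ?C" if s: "s \<in> cball a (r / 2)" for s
  proof -
    have "g holomorphic_on cball s (r / 2)"
      using assms(1,3) sub[OF s] by (meson holomorphic_on_subset order_trans)
    then have "g holomorphic_on ball s (r / 2)" "continuous_on (cball s (r / 2)) g"
      using holomorphic_on_subset ball_subset_cball holomorphic_on_imp_continuous_on by blast+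
    then have "norm ((deriv ^^ 2) g s) \<le> fact 2 * M / (r / 2)\<^sup>2"
    proof (rule Cauchy_inequality)
      show "norm (g x) \<le> M" if "norm (s - x) = r / 2" for x
        using that sub[OF s] by (intro bound) (auto simp: dist_norm)
    qed (use \<open>0 < r\<close> in simp)
    then show ?thesis by (simp add: power_divide)
  qed
  moreover have "((deriv ^^ i) g has_field_derivative (deriv ^^ Suc i) g s) (at s within cball a (r / 2))"
    if "s \<in> cball a (r / 2)" for s i
  proof -
    have "s \<in> cball s (r / 2)" using \<open>0 < r\<close> by simp
    then have "s \<in> S" using sub[OF that] assms(3) by blast
    then show ?thesis
      by (rule has_field_derivative_at_within[OF has_field_derivative_higher_deriv[OF assms(1,2)]])
  qed
  ultimately have "norm ((deriv ^^ 0) g (a + h) - (\<Sum>i\<le>1. (deriv ^^ i) g a * (a + h - a) ^ i / fact i))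
      \<le> ?C * norm (a + h - a) ^ Suc 1 / fact 1"
    using h(2) \<open>0 < r\<close>
    by (intro complex_Taylor[where S = "cball a (r / 2)"])
      (auto simp: dist_norm eval_nat_numeral)
  then have "norm (g (a + h) - g a - deriv g a * h) \<le> ?C * norm h * norm h"
    by (simp add: diff_diff_eq power2_eq_square mult.assoc)
  moreover have "(g (a + h) - g a) / h - deriv g a = (g (a + h) - g a - deriv g a * h) / h"
    using h(1) by (simp add: field_simps)
  ultimately show ?thesis
    using h(1) by (simp add: norm_divide pos_divide_le_eq)
qed

text \<open>The partial derivative is a limit of difference quotients, each holomorphic in the other variable.
  The limit is locally uniform because \<open>f\<close> is bounded on compact bidiscs.\<close>

lemma holomorphic2_on_partial_deriv:
  assumes f: "holomorphic2_on f (A \<times> B)" and "open A" "open B" "a \<in> A"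
  shows "(\<lambda>b. deriv (\<lambda>a. f (a, b)) a) holomorphic_on B"
proof -
  obtain r where r: "0 < r" "cball a r \<subseteq> A"
    using \<open>open A\<close> \<open>a \<in> A\<close> open_contains_cball by blast
  \<comment> \<open>increments tending to \<open>0\<close> inside the disc of radius \<open>r / 2\<close> where the bound applies\<close>
  define h :: "nat \<Rightarrow> complex" where "h = (\<lambda>n. of_real (r / 2 * inverse (real (Suc n))))"
  have h: "h n \<noteq> 0" "norm (h n) = r / 2 * inverse (real (Suc n))" "norm (h n) \<le> r / 2" for n
  proof -
    show "h n \<noteq> 0" using r(1) by (simp add: h_def del: of_nat_Suc)
    show eq: "norm (h n) = r / 2 * inverse (real (Suc n))"
      unfolding h_def norm_of_real using r(1) by (simp add: abs_mult del: of_nat_Suc)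
    show "norm (h n) \<le> r / 2"
      unfolding eq using r(1) by (intro mult_right_le_one_le) (auto simp: inverse_le_1_iff)
  qed
  have ah: "a + h n \<in> A" for n
    using h(3)[of n] r by (auto simp: dist_norm)
  show ?thesis
  proof (rule holomorphic_uniform_sequence[OF \<open>open B\<close>])
    show "(\<lambda>b. (f (a + h n, b) - f (a, b)) / h n) holomorphic_on B" for n
      by (intro holomorphic_intros holomorphic2_on_slices(2)[OF f] ah \<open>a \<in> A\<close>) (simp add: h)
    fix x assume "x \<in> B"
    then obtain d where d: "0 < d" "cball x d \<subseteq> B"
      using \<open>open B\<close> open_contains_cball by blast
    have "compact (f ` (cball a r \<times> cball x d))"
      using r(2) d(2)
      by (intro compact_continuous_image compact_Times compact_cball
          continuous_on_subset[OF holomorphic2_on_imp_continuous_on[OF f]]) auto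
    then have "bounded (f ` (cball a r \<times> cball x d))" by (rule compact_imp_bounded)
    then obtain M where "\<forall>y\<in>f ` (cball a r \<times> cball x d). norm y \<le> M"
      unfolding bounded_iff by blast
    then have M: "norm (f (s, b)) \<le> M" if "s \<in> cball a r" "b \<in> cball x d" for s b
      using that by blast
    have est: "norm ((f (a + h n, b) - f (a, b)) / h n - deriv (\<lambda>a. f (a, b)) a)
        \<le> 8 * M / r\<^sup>2 * norm (h n)" if "b \<in> cball x d" for n b
      using that d(2) M h
      by (intro difference_quotient_bound[OF holomorphic2_on_slices(1)[OF f] \<open>open A\<close> r(2,1)]) auto
    have lim: "(\<lambda>n. 8 * M / r\<^sup>2 * norm (h n)) \<longlonglongrightarrow> 0"
      unfolding h(2) by (intro tendsto_mult_right_zero LIMSEQ_inverse_real_of_nat)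
    have "uniform_limit (cball x d) (\<lambda>n b. (f (a + h n, b) - f (a, b)) / h n)
        (\<lambda>b. deriv (\<lambda>a. f (a, b)) a) sequentially"
    proof (rule uniform_limitI)
      fix e :: real assume "0 < e"
      with lim have "\<forall>\<^sub>F n in sequentially. 8 * M / r\<^sup>2 * norm (h n) < e"
        by (rule order_tendstoD)
      then show "\<forall>\<^sub>F n in sequentially. \<forall>b\<in>cball x d.
          dist ((f (a + h n, b) - f (a, b)) / h n) (deriv (\<lambda>a. f (a, b)) a) < e"
      proof eventually_elim
        case (elim n)
        show ?case unfolding dist_norm by (intro ballI le_less_trans[OF est elim])
      qed
    qed
    with d show "\<exists>d>0. cball x d \<subseteq> B \<and> uniform_limit (cball x d)
        (\<lambda>n b. (f (a + h n, b) - f (a, b)) / h n) (\<lambda>b. deriv (\<lambda>a. f (a, b)) a) sequentially"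
      by blast
  qed
qed

section \<open>The equation for the holomorphic part\<close>

text \<open>Writing a solution of \<open>G' = (X\<^sub>g/z + X\<^sub>g\<^sub>g/(1 - z) + w X\<^sub>1\<^sub>2/(1 - wz)) G\<close> as \<open>G = F z\<^bsup>X\<^sub>g\<^esup>\<close> turns the equation into
  \<open>z F' = [X\<^sub>g, F] + z (X\<^sub>g\<^sub>g/(1 - z) + w X\<^sub>1\<^sub>2/(1 - wz)) F\<close>, whose right-hand side is holomorphic at
  \<open>z = 0\<close> and is given here.\<close>

definition kz_op :: "kz_gen \<Rightarrow> kz_gen \<Rightarrow> complex \<Rightarrow> complex \<Rightarrow> kz_cuea \<Rightarrow> kz_cuea" where
  "kz_op g gg w z u = kz_X g * u - u * kz_X g
     + (z / (1 - z)) *\<^sub>C (kz_X gg * u) + (z * w / (1 - w * z)) *\<^sub>C (kz_X X12 * u)"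

text \<open>The derivative is formed after applying the functionals, so that the equation makes sense at
  \<open>z = 0\<close> without exhibiting the value of \<open>F'\<close> there as an element of the completion.\<close>

definition kz_regular :: "complex set \<Rightarrow> kz_gen \<Rightarrow> kz_gen \<Rightarrow> complex \<Rightarrow> (complex \<Rightarrow> kz_cuea) \<Rightarrow> bool" where
  "kz_regular D g gg w F \<longleftrightarrow> holo1 F D \<and>
    (\<forall>n \<phi>. complex_functional \<phi> \<longrightarrow> (\<forall>z\<in>D.
      z * deriv (\<lambda>z. \<phi> (component n (F z))) z = \<phi> (component n (kz_op g gg w z (F z)))))"

lemma holo1_add: "holo1 F D \<Longrightarrow> holo1 G D \<Longrightarrow> holo1 (\<lambda>z. F z + G z) D"
  unfolding holo1_def
  by (auto simp: component_add functional_add intro!: holomorphic_on_add)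

lemma holo1_scaleC: "c holomorphic_on D \<Longrightarrow> holo1 F D \<Longrightarrow> holo1 (\<lambda>z. c z *\<^sub>C F z) D"
  unfolding holo1_def
  by (auto simp: component_scaleC functional_scaleC intro!: holomorphic_on_mult)

lemma holo1_kz_op:
  assumes "holo1 F D" "w holomorphic_on D" "z holomorphic_on D"
    and "\<And>x. x \<in> D \<Longrightarrow> z x \<noteq> 1" "\<And>x. x \<in> D \<Longrightarrow> w x * z x \<noteq> 1"
  shows "holo1 (\<lambda>x. kz_op g gg (w x) (z x) (F x)) D"
proof -
  have "(\<lambda>x. z x / (1 - z x)) holomorphic_on D" "(\<lambda>x. z x * w x / (1 - w x * z x)) holomorphic_on D"
    using assms(2-5)
    by (auto intro!: holomorphic_on_divide holomorphic_on_diff holomorphic_on_mult holomorphic_on_const)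
  then show ?thesis
    unfolding kz_op_def using assms(1)
    by (intro holo1_add holo1_diff holo1_scaleC holo1_mult holo1_const)
qed

lemma kz_op_diff: "kz_op g gg w z u - kz_op g gg w z v = kz_op g gg w z (u - v)"
  by (simp add: kz_op_def algebra_simps complex_vector.scale_right_diff_distrib)

lemma kz_op_mult_right:
  assumes "u * kz_X g = kz_X g * u"
  shows "kz_op g gg w z (v * u) = kz_op g gg w z v * u"
proof -
  have "v * u * kz_X g = v * kz_X g * u" by (metis assms mult.assoc)
  then show ?thesis
    by (simp add: kz_op_def distrib_right left_diff_distrib mult_scaleC_left flip: mult.assoc)
qed

lemma component_kz_op_0: "component 0 (kz_op g gg w z u) = 0"
  by (simp add: kz_op_def component_add component_diff component_scaleC component_X_mult component_mult_X
      complex_vector.scale_zero_right)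

text \<open>The operator raises the degree by one; this drives the induction on degrees in the uniqueness
  proof.\<close>

lemma component_kz_op_Suc:
  assumes "component n u = 0"
  shows "component (Suc n) (kz_op g gg w z u) = 0"
  using assms
  by (simp add: kz_op_def component_add component_diff component_scaleC component_X_mult component_mult_X
      complex_vector.scale_zero_right)

lemma log_branch_nonzero: "log_branch U l \<Longrightarrow> z \<in> U \<Longrightarrow> z \<noteq> 0"
  unfolding log_branch_def by (metis exp_not_eq_zero)

lemma log_branch_deriv:
  assumes "log_branch U l" "z \<in> U"
  shows "(l has_field_derivative 1 / z) (at z)"
proof -
  have U: "open U" "l holomorphic_on U" "\<And>z. z \<in> U \<Longrightarrow> exp (l z) = z"
    using assms(1) by (auto simp: log_branch_def)
  have 1: "(l has_field_derivative deriv l z) (at z)"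
    using U assms(2) by (simp add: holomorphic_derivI)
  then have "((\<lambda>z. exp (l z)) has_field_derivative z * deriv l z) (at z)"
    using U(3)[OF assms(2)] by (auto intro!: derivative_eq_intros)
  moreover have "((\<lambda>z. exp (l z)) has_field_derivative 1) (at z)"
    by (rule has_field_derivative_transform_within_open[OF DERIV_ident U(1) assms(2)]) (simp add: U(3))
  ultimately have "z * deriv l z = 1" by (rule DERIV_unique)
  then have "deriv l z = 1 / z" using log_branch_nonzero[OF assms] by (simp add: field_simps)
  with 1 show ?thesis by simp
qed

lemma kz_pow_inverse: "kz_pow l z g * kz_exp ((- l z) *\<^sub>C kz_X g) = 1"
  unfolding kz_pow_def kz_exp_X_add by (simp only: add.right_inverse kz_exp_0)

lemma coeff2_mult:
  assumes "z \<noteq> 0"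
  shows "coeff2 g gg w z * u = (1 / z) *\<^sub>C kz_op g gg w z u + (1 / z) *\<^sub>C (u * kz_X g)"
  using assms
  by (simp add: coeff2_def kz_op_def distrib_right mult_scaleC_left scaleC_add_right scaleC_scaleC
      complex_vector.scale_right_diff_distrib)

text \<open>Multiplication by the power of \<open>z\<close> and by its inverse, with the product rule, passes from \<open>F\<close> to
  the solution and back.\<close>

lemma has_deriv1_ode_sol_iff:
  assumes "log_branch U l" "z \<in> U"
  shows "has_deriv1 (ode_sol l g F) (coeff2 g gg w z * ode_sol l g F z) z \<longleftrightarrow>
    has_deriv1 F ((1 / z) *\<^sub>C kz_op g gg w z (F z)) z"
proof -
  note z = log_branch_nonzero[OF assms]
  let ?X = "kz_X g" and ?E = "\<lambda>z. kz_pow l z g" and ?I = "\<lambda>z. kz_exp ((- l z) *\<^sub>C kz_X g)"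
  have dE: "has_deriv1 ?E ((1 / z) *\<^sub>C (?X * ?E z)) z"
    unfolding kz_pow_def by (rule has_deriv1_kz_exp[OF log_branch_deriv[OF assms]])
  have dI: "has_deriv1 ?I ((- (1 / z)) *\<^sub>C (?X * ?I z)) z"
    by (rule has_deriv1_kz_exp[OF DERIV_minus[OF log_branch_deriv[OF assms]]])
  show ?thesis
  proof
    assume "has_deriv1 F ((1 / z) *\<^sub>C kz_op g gg w z (F z)) z"
    from has_deriv1_mult[OF this dE]
    show "has_deriv1 (ode_sol l g F) (coeff2 g gg w z * ode_sol l g F z) z"
      by (simp add: ode_sol_def[abs_def] coeff2_mult[OF z] distrib_right mult_scaleC_left
          mult_scaleC_right flip: mult.assoc)
  next
    assume "has_deriv1 (ode_sol l g F) (coeff2 g gg w z * ode_sol l g F z) z"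
    from has_deriv1_mult[OF this dI]
    have *: "has_deriv1 (\<lambda>z. ode_sol l g F z * ?I z)
      (coeff2 g gg w z * (ode_sol l g F z * ?I z) - (1 / z) *\<^sub>C (ode_sol l g F z * ?I z * ?X)) z"
      using kz_exp_X_commute[of ?X g "- l z"]
      by (simp add: mult_scaleC_right mult.assoc)
    have "ode_sol l g F z * ?I z = F z" for z
      by (simp only: ode_sol_def mult.assoc kz_pow_inverse mult_1_right)
    with * show "has_deriv1 F ((1 / z) *\<^sub>C kz_op g gg w z (F z)) z"
      by (simp add: coeff2_mult[OF z])
  qed
qed

lemma has_deriv1_iff_deriv:
  assumes "holo1 F D" "open D" "z \<in> D" "z \<noteq> 0"
  shows "has_deriv1 F ((1 / z) *\<^sub>C u) z \<longleftrightarrow>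
    (\<forall>n \<phi>. complex_functional \<phi> \<longrightarrow> z * deriv (\<lambda>z. \<phi> (component n (F z))) z = \<phi> (component n u))"
proof -
  have "((\<lambda>z. \<phi> (component n (F z))) has_field_derivative \<phi> (component n ((1 / z) *\<^sub>C u))) (at z) \<longleftrightarrow>
      z * deriv (\<lambda>z. \<phi> (component n (F z))) z = \<phi> (component n u)" if "complex_functional \<phi>" for n \<phi>
  proof -
    have "(\<lambda>z. \<phi> (component n (F z))) holomorphic_on D"
      using assms(1) that by (auto simp: holo1_def)
    then have "((\<lambda>z. \<phi> (component n (F z))) has_field_derivative deriv (\<lambda>z. \<phi> (component n (F z))) z) (at z)"
      using assms(2,3) by (rule holomorphic_derivI)
    then have "((\<lambda>z. \<phi> (component n (F z))) has_field_derivative d) (at z) \<longleftrightarrow>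
        deriv (\<lambda>z. \<phi> (component n (F z))) z = d" for d
      using DERIV_unique by blast
    then show ?thesis
      using assms(4) that by (simp add: component_scaleC functional_scaleC field_simps)
  qed
  then show ?thesis by (auto simp: has_deriv1_def)
qed

text \<open>On \<open>U\<close> the two forms of the equation agree. Since the regular form involves only functions
  holomorphic on all of \<open>D\<close>, it spreads from \<open>U\<close> to \<open>D\<close> by the identity theorem, also across
  the branch point \<open>0\<close>.\<close>

lemma kz_regular_iff_ode_sol:
  assumes D: "open D" "connected D" "1 \<notin> D" "\<And>z. z \<in> D \<Longrightarrow> w * z \<noteq> 1"
    and U: "log_branch U l" "U \<subseteq> D" "U \<noteq> {}"
  shows "kz_regular D g gg w F \<longleftrightarrow> holo1 F D \<and>
    (\<forall>z\<in>U. has_deriv1 (ode_sol l g F) (coeff2 g gg w z * ode_sol l g F z) z)"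
proof -
  have pointwise: "has_deriv1 (ode_sol l g F) (coeff2 g gg w z * ode_sol l g F z) z \<longleftrightarrow>
      (\<forall>n \<phi>. complex_functional \<phi> \<longrightarrow>
        z * deriv (\<lambda>z. \<phi> (component n (F z))) z = \<phi> (component n (kz_op g gg w z (F z))))"
    if "z \<in> U" "holo1 F D" for z
    using has_deriv1_ode_sol_iff[OF U(1) that(1)] U(2) that
      has_deriv1_iff_deriv[OF that(2) D(1) _ log_branch_nonzero[OF U(1) that(1)]] by auto
  have "z * deriv (\<lambda>z. \<phi> (component n (F z))) z = \<phi> (component n (kz_op g gg w z (F z)))"
    if "holo1 F D" "complex_functional \<phi>" "z \<in> D"
      and *: "\<And>z. z \<in> U \<Longrightarrow> z * deriv (\<lambda>z. \<phi> (component n (F z))) z = \<phi> (component n (kz_op g gg w z (F z)))"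
    for n \<phi> z
  proof (rule analytic_continuation_open[OF _ D(1) U(3) D(2) U(2) _ _ * that(3)])
    show "open U" using U(1) by (simp add: log_branch_def)
    show "(\<lambda>z. z * deriv (\<lambda>z. \<phi> (component n (F z))) z) holomorphic_on D"
      using that(1,2) D(1) by (auto simp: holo1_def intro!: holomorphic_intros holomorphic_deriv)
    have "holo1 (\<lambda>z. kz_op g gg w z (F z)) D"
      using D(3,4) by (intro holo1_kz_op[OF that(1)]) auto
    then show "(\<lambda>z. \<phi> (component n (kz_op g gg w z (F z)))) holomorphic_on D"
      using that(2) by (auto simp: holo1_def)
  qed
  then show ?thesis
    unfolding kz_regular_def using pointwise U(2) by blast
qed

text \<open>Here \<open>z f' = 0\<close> for every functional \<open>f\<close> of the component, so \<open>f'\<close> vanishes off \<open>0\<close>, hence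
  by analyticity on all of \<open>D\<close>, and \<open>f\<close> is constant because \<open>D\<close> is connected.\<close>

lemma kz_regular_const_component:
  assumes "kz_regular D g gg w F" "open D" "connected D" "0 \<in> D"
    and "\<And>z. z \<in> D \<Longrightarrow> component n (kz_op g gg w z (F z)) = 0" "z \<in> D"
  shows "component n (F z) = component n (F 0)"
proof (rule component_eqI)
  fix \<phi> :: "kz_lie uea \<Rightarrow> complex" assume \<phi>: "complex_functional \<phi>"
  let ?f = "\<lambda>z. \<phi> (component n (F z))"
  have hol: "?f holomorphic_on D" using assms(1) \<phi> by (auto simp: kz_regular_def holo1_def)
  have 0: "z * deriv ?f z = 0" if "z \<in> D" for z
    using assms(1,5) \<phi> that by (auto simp: kz_regular_def functional_zero)
  have "deriv ?f z = 0" if "z \<in> D" for z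
  proof (rule analytic_continuation_open[where s = "D - {0}" and s' = D and f = "deriv ?f" and g = "\<lambda>_. 0"])
    show "D - {0} \<noteq> {}"
      using \<open>open D\<close> \<open>0 \<in> D\<close> not_open_singleton[of "0::complex"] by (metis Diff_eq_empty_iff empty_iff subset_singletonD)
    show "deriv ?f z = 0" if "z \<in> D - {0}" for z using 0[of z] that by simp
  qed (use hol assms that in \<open>auto intro!: holomorphic_deriv\<close>)
  then have "(?f has_field_derivative 0) (at z)" if "z \<in> D" for z
    using holomorphic_derivI[OF hol \<open>open D\<close> that] that by simp
  then obtain c where "\<And>z. z \<in> D \<Longrightarrow> ?f z = c"
    using DERIV_zero_connected_constant[of D "{}" ?f] assms(2,3) hol
      holomorphic_on_imp_continuous_on by (metis Diff_iff finite.emptyI)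
  then show "?f z = ?f 0" using assms(4,6) by simp
qed

lemma kz_regular_diff:
  assumes "kz_regular D g gg w F" "kz_regular D g gg w G" "open D"
  shows "kz_regular D g gg w (\<lambda>z. F z - G z)"
  unfolding kz_regular_def
proof (intro conjI allI impI ballI)
  show "holo1 (\<lambda>z. F z - G z) D" using assms by (simp add: kz_regular_def holo1_diff)
  fix n and \<phi> :: "kz_lie uea \<Rightarrow> complex" and z assume \<phi>: "complex_functional \<phi>" and "z \<in> D"
  have "(\<lambda>z. \<phi> (component n (F z))) field_differentiable at z"
    "(\<lambda>z. \<phi> (component n (G z))) field_differentiable at z"
    using assms \<phi> \<open>z \<in> D\<close>
    by (auto simp: kz_regular_def holo1_def intro!: holomorphic_on_imp_differentiable_at)
  then show "z * deriv (\<lambda>z. \<phi> (component n (F z - G z))) z =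
      \<phi> (component n (kz_op g gg w z (F z - G z)))"
    using assms \<phi> \<open>z \<in> D\<close> unfolding kz_regular_def
    by (simp add: component_diff functional_diff right_diff_distrib flip: kz_op_diff)
qed

text \<open>Apart from the commutator with \<open>X\<^sub>g\<close>, the operator multiplies from the left only, so right
  multiplication by a constant preserves solutions when the constant commutes with \<open>X\<^sub>g\<close>. The Cauchy product with
  a fixed right factor is a sum of functionals of the components of \<open>F\<close>.\<close>

lemma kz_regular_mult_const:
  assumes "kz_regular D g gg w F" "open D" "u * kz_X g = kz_X g * u"
  shows "kz_regular D g gg w (\<lambda>z. F z * u)"
  unfolding kz_regular_def
proof (intro conjI allI impI ballI)
  show "holo1 (\<lambda>z. F z * u) D"
    using assms(1) by (intro holo1_mult holo1_const) (simp add: kz_regular_def)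
  fix n and \<phi> :: "kz_lie uea \<Rightarrow> complex" and z assume \<phi>: "complex_functional \<phi>" and z: "z \<in> D"
  let ?\<phi> = "\<lambda>i v. \<phi> (v * component (n - i) u)"
  have expand: "\<phi> (component n (v * u)) = (\<Sum>i=0..n. ?\<phi> i (component i v))" for v
    by (simp add: component_mult functional_sum[OF \<phi>])
  have "((\<lambda>z. ?\<phi> i (component i (F z))) has_field_derivative deriv (\<lambda>z. ?\<phi> i (component i (F z))) z) (at z)" for i
    using assms(1) functional_mult_right[OF \<phi>] \<open>open D\<close> z
    by (intro holomorphic_derivI[of _ D]) (auto simp: kz_regular_def holo1_def)
  then have "((\<lambda>z. \<phi> (component n (F z * u))) has_field_derivative
      (\<Sum>i=0..n. deriv (\<lambda>z. ?\<phi> i (component i (F z))) z)) (at z)"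
    unfolding expand by (intro DERIV_sum)
  then have "z * deriv (\<lambda>z. \<phi> (component n (F z * u))) z =
      (\<Sum>i=0..n. z * deriv (\<lambda>z. ?\<phi> i (component i (F z))) z)"
    by (simp add: DERIV_imp_deriv sum_distrib_left)
  also have "\<dots> = (\<Sum>i=0..n. ?\<phi> i (component i (kz_op g gg w z (F z))))"
    using assms(1) functional_mult_right[OF \<phi>] z by (intro sum.cong) (auto simp: kz_regular_def)
  finally show "z * deriv (\<lambda>z. \<phi> (component n (F z * u))) z = \<phi> (component n (kz_op g gg w z (F z * u)))"
    unfolding kz_op_mult_right[OF assms(3)] expand .
qed

text \<open>The difference of two solutions solves the equation and vanishes at \<open>0\<close>. If its component of degree
  \<open>n\<close> is zero, the right-hand side vanishes in degree \<open>n + 1\<close>, so that component is constant,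
  hence zero.\<close>

lemma kz_regular_unique:
  assumes "kz_regular D g gg w F" "kz_regular D g gg w G" "F 0 = G 0"
    and D: "open D" "connected D" "0 \<in> D" and "z \<in> D"
  shows "F z = G z"
proof (rule kz_cuea_eqI)
  let ?R = "\<lambda>z. F z - G z"
  note reg = kz_regular_diff[OF assms(1,2) D(1)]
  have "component n (?R z) = 0" if "z \<in> D" for n z
    using that
  proof (induction n arbitrary: z)
    case 0
    then show ?case
      using kz_regular_const_component[OF reg D component_kz_op_0 0] assms(3) by (simp add: component_zero)
  next
    case (Suc n)
    then show ?case
      using kz_regular_const_component[OF reg D component_kz_op_Suc[OF Suc.IH]] assms(3)
      by (simp add: component_zero)
  qed
  with \<open>z \<in> D\<close> show "component n (F z) = component n (G z)" for n
    by (simp add: component_diff)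
qed

section \<open>From the two-variable system to equations in each variable\<close>

lemma holo2_slices:
  assumes "holo2 L (A \<times> B)"
  shows "b \<in> B \<Longrightarrow> holo1 (\<lambda>a. L (a, b)) A" and "a \<in> A \<Longrightarrow> holo1 (\<lambda>b. L (a, b)) B"
  using assms holomorphic2_on_slices[of _ A B] unfolding holo1_def holo2_def by blast+

text \<open>Both sides of the equation in \<open>a\<close> are holomorphic in the parameter \<open>b\<close>, the left one because the
  partial derivative of a holomorphic function is. The identity theorem in \<open>b\<close> applies.\<close>

lemma kz_regular_continue_parameter:
  assumes "holo2 L (A \<times> B)" "open A" "1 \<notin> A" "open B" "connected B" "\<forall>a\<in>A. \<forall>b\<in>B. b * a \<noteq> 1"
    and V: "open V" "V \<subseteq> B" "V \<noteq> {}" "\<And>b. b \<in> V \<Longrightarrow> kz_regular A g gg b (\<lambda>a. L (a, b))"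
    and "b \<in> B"
  shows "kz_regular A g gg b (\<lambda>a. L (a, b))"
  unfolding kz_regular_def
proof (intro conjI allI impI ballI)
  show "holo1 (\<lambda>a. L (a, b)) A" using holo2_slices(1)[OF assms(1)] \<open>b \<in> B\<close> .
  fix n and \<phi> :: "kz_lie uea \<Rightarrow> complex" and a assume \<phi>: "complex_functional \<phi>" and a: "a \<in> A"
  show "a * deriv (\<lambda>a. \<phi> (component n (L (a, b)))) a = \<phi> (component n (kz_op g gg b a (L (a, b))))"
  proof (rule analytic_continuation_open[OF V(1) \<open>open B\<close> V(3) \<open>connected B\<close> V(2) _ _ _ \<open>b \<in> B\<close>])
    have "holomorphic2_on (\<lambda>z. \<phi> (component n (L z))) (A \<times> B)"
      using assms(1) \<phi> by (simp add: holo2_def)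
    from holomorphic2_on_partial_deriv[OF this \<open>open A\<close> \<open>open B\<close> a]
    show "(\<lambda>b. a * deriv (\<lambda>a. \<phi> (component n (L (a, b)))) a) holomorphic_on B"
      by (intro holomorphic_on_mult holomorphic_on_const)
    have "holo1 (\<lambda>b. kz_op g gg b a (L (a, b))) B"
      using assms(3,6) a holo2_slices(2)[OF assms(1) a]
      by (intro holo1_kz_op holomorphic_on_ident holomorphic_on_const) auto
    then show "(\<lambda>b. \<phi> (component n (kz_op g gg b a (L (a, b))))) holomorphic_on B"
      using \<phi> by (simp add: holo1_def)
  qed (use V(4) \<phi> a in \<open>auto simp: kz_regular_def\<close>)
qed

lemma kz_form_axes:
  "kz_form (a, b) (h, 0) = h *\<^sub>C coeff2 X1 X11 b a"
  "kz_form (a, b) (0, h) = h *\<^sub>C coeff2 X2 X22 a b"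
  by (simp_all add: kz_form_def coeff2_def scaleC_add_right scaleC_scaleC complex_vector.scale_zero_left
      mult.commute)

lemma has_differential2_axes:
  assumes "has_differential2 S (\<lambda>h. kz_form (a, b) h * u) (a, b)"
  shows "has_deriv1 (\<lambda>a. S (a, b)) (coeff2 X1 X11 b a * u) a"
    and "has_deriv1 (\<lambda>b. S (a, b)) (coeff2 X2 X22 a b * u) b"
proof -
  have fst: "((\<lambda>a. (a, b)) has_derivative (\<lambda>h. (h, 0))) (at a)"
    and snd: "((\<lambda>b. (a, b)) has_derivative (\<lambda>h. (0, h))) (at b)"
    by (auto intro!: derivative_eq_intros)
  have S: "((\<lambda>w. \<phi> (component n (S w))) has_derivative (\<lambda>h. \<phi> (component n (kz_form (a, b) h * u)))) (at (a, b))"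
    if "complex_functional \<phi>" for n \<phi>
    using assms that unfolding has_differential2_def by blast
  have "((\<lambda>a. \<phi> (component n (S (a, b)))) has_field_derivative
      \<phi> (component n (coeff2 X1 X11 b a * u))) (at a)" if "complex_functional \<phi>" for n \<phi>
    using has_derivative_compose[OF fst S[OF that]] that
    by (simp add: has_field_derivative_def kz_form_axes mult_scaleC_left component_scaleC functional_scaleC
        mult.commute[of _ "\<phi> _"])
  then show "has_deriv1 (\<lambda>a. S (a, b)) (coeff2 X1 X11 b a * u) a"
    by (simp add: has_deriv1_def)
  have "((\<lambda>b. \<phi> (component n (S (a, b)))) has_field_derivative
      \<phi> (component n (coeff2 X2 X22 a b * u))) (at b)" if "complex_functional \<phi>" for n \<phi>
    using has_derivative_compose[OF snd S[OF that]] that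
    by (simp add: has_field_derivative_def kz_form_axes mult_scaleC_left component_scaleC functional_scaleC
        mult.commute[of _ "\<phi> _"])
  then show "has_deriv1 (\<lambda>b. S (a, b)) (coeff2 X2 X22 a b * u) b"
    by (simp add: has_deriv1_def)
qed

text \<open>By the first defining relation of the Lie algebra the two powers \<open>z\<^sub>1\<^bsup>X\<^sub>1\<^esup>\<close> and
  \<open>z\<^sub>2\<^bsup>X\<^sub>2\<^esup>\<close> can change places.\<close>

lemma X1_X2_commute: "kz_X X1 * kz_X X2 = kz_X X2 * kz_X X1"
proof (rule kz_cuea_eqI)
  have "lie (kz_lie_gen X1) (kz_lie_gen X2) = 0"
    by transfer (intro kz_lcong.rel kz_rel.intros)
  moreover have "uea_in (0 :: kz_lie) = 0"
    using uea_in_lie[of 0 "0 :: kz_lie"] lie_self[of "0 :: kz_lie"] by simp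
  ultimately have "uea_in (kz_lie_gen X1) * uea_in (kz_lie_gen X2) =
      uea_in (kz_lie_gen X2) * uea_in (kz_lie_gen X1)"
    using uea_in_lie[of "kz_lie_gen X1" "kz_lie_gen X2"] by simp
  then show "component n (kz_X X1 * kz_X X2) = component n (kz_X X2 * kz_X X1)" for n
    by (simp add: component_X_mult component_kz_X)
qed

lemma kz_pow_commute:
  assumes "kz_X g * kz_X h = kz_X h * kz_X g"
  shows "kz_pow l z g * kz_pow m w h = kz_pow m w h * kz_pow l z g"
proof -
  have "kz_X h * kz_pow l z g = kz_pow l z g * kz_X h"
    unfolding kz_pow_def using assms by (intro kz_exp_X_commute) simp
  then show ?thesis
    unfolding kz_pow_def[of m] by (intro kz_exp_X_commute) simp
qed

text \<open>Evaluating the differential on a coordinate direction gives an ordinary differential equation for each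
  parameter value in \<open>U\<^sub>2\<close> (or \<open>U\<^sub>1\<close>), from which the power of the other variable is cancelled as a
  constant right factor. This needs that factor to stand rightmost, hence commuting powers. The
  equation extends to \<open>D\<^sub>1\<close> (or \<open>D\<^sub>2\<close>) in its variable, and then to all parameter values.\<close>

lemma kz_fundamental_kz_regular:
  assumes D: "open D1" "connected D1" "1 \<notin> D1" "open D2" "connected D2" "1 \<notin> D2"
      "\<forall>z1\<in>D1. \<forall>z2\<in>D2. z1 * z2 \<noteq> 1"
    and U: "log_branch U1 l1" "U1 \<subseteq> D1" "U1 \<noteq> {}" "log_branch U2 l2" "U2 \<subseteq> D2" "U2 \<noteq> {}"
    and L: "kz_fundamental (D1 \<times> D2) (U1 \<times> U2) l1 l2 L"
  shows "b \<in> D2 \<Longrightarrow> kz_regular D1 X1 X11 b (\<lambda>a. L (a, b))"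
    and "a \<in> D1 \<Longrightarrow> kz_regular D2 X2 X22 a (\<lambda>b. L (a, b))"
proof -
  have open_U: "open U1" "open U2" using U by (auto simp: log_branch_def)
  have holo: "holo2 L (D1 \<times> D2)" using L by (simp add: kz_fundamental_def)
  have diff: "has_differential2 (kz_sol l1 l2 L) (\<lambda>h. kz_form (a, b) h * kz_sol l1 l2 L (a, b)) (a, b)"
    if "a \<in> U1" "b \<in> U2" for a b
    using L that by (auto simp: kz_fundamental_def)
  have sol1: "kz_sol l1 l2 L (a, b) = ode_sol l1 X1 (\<lambda>a. L (a, b)) a * kz_pow l2 b X2" for a b
    by (simp add: kz_sol_def ode_sol_def)
  have sol2: "kz_sol l1 l2 L (a, b) = ode_sol l2 X2 (\<lambda>b. L (a, b)) b * kz_pow l1 a X1" for a b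
    by (simp add: kz_sol_def ode_sol_def mult.assoc kz_pow_commute[OF X1_X2_commute])
  have cancel: "has_deriv1 F (A * F z) z"
    if "has_deriv1 (\<lambda>z. F z * kz_pow l w g) (A * (F z * kz_pow l w g)) z" for F A z l w g
    using has_deriv1_mult_const[OF that, of "kz_exp ((- l w) *\<^sub>C kz_X g)"]
    by (simp only: mult.assoc kz_pow_inverse mult_1_right)
  have ode1: "has_deriv1 (ode_sol l1 X1 (\<lambda>a. L (a, b)))
      (coeff2 X1 X11 b a * ode_sol l1 X1 (\<lambda>a. L (a, b)) a) a" if "a \<in> U1" "b \<in> U2" for a b
    using has_differential2_axes(1)[OF diff[OF that]] unfolding sol1 by (rule cancel)
  have ode2: "has_deriv1 (ode_sol l2 X2 (\<lambda>b. L (a, b)))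
      (coeff2 X2 X22 a b * ode_sol l2 X2 (\<lambda>b. L (a, b)) b) b" if "a \<in> U1" "b \<in> U2" for a b
    using has_differential2_axes(2)[OF diff[OF that]] unfolding sol2 by (rule cancel)
  show "kz_regular D1 X1 X11 b (\<lambda>a. L (a, b))" if "b \<in> D2"
  proof (rule kz_regular_continue_parameter[OF holo D(1,3,4,5) _ open_U(2) U(5,6) _ that])
    show "\<forall>a\<in>D1. \<forall>b\<in>D2. b * a \<noteq> 1" using D(7) by (simp add: mult.commute)
    fix b assume b: "b \<in> U2"
    show "kz_regular D1 X1 X11 b (\<lambda>a. L (a, b))"
      using D(7) U(5) b holo2_slices(1)[OF holo, of b] ode1
      by (subst kz_regular_iff_ode_sol[OF D(1-3) _ U(1-3)]) (auto simp: mult.commute)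
  qed
  show "kz_regular D2 X2 X22 a (\<lambda>b. L (a, b))" if "a \<in> D1"
  proof -
    have "holo2 (\<lambda>z. L (snd z, fst z)) (D2 \<times> D1)"
      unfolding holo2_def
    proof (intro allI impI)
      fix n and \<phi> :: "kz_lie uea \<Rightarrow> complex" assume "complex_functional \<phi>"
      with holo have "holomorphic2_on (\<lambda>z. \<phi> (component n (L z))) (D1 \<times> D2)" by (simp add: holo2_def)
      from holomorphic2_on_swap[OF this]
      show "holomorphic2_on (\<lambda>z. \<phi> (component n (L (snd z, fst z)))) (D2 \<times> D1)" .
    qed
    then have "kz_regular D2 X2 X22 a (\<lambda>b. (\<lambda>z. L (snd z, fst z)) (b, a))"
    proof (rule kz_regular_continue_parameter[OF _ D(4,6,1,2) _ open_U(1) U(2,3) _ that])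
      show "\<forall>b\<in>D2. \<forall>a\<in>D1. a * b \<noteq> 1" using D(7) by blast
      fix a assume a: "a \<in> U1"
      show "kz_regular D2 X2 X22 a (\<lambda>b. (\<lambda>z. L (snd z, fst z)) (b, a))"
        using D(7) U(2) a holo2_slices(2)[OF holo, of a] ode2
        by (subst kz_regular_iff_ode_sol[OF D(4-6) _ U(4-6)]) auto
    qed
    then show ?thesis by simp
  qed
qed

section \<open>The decomposition\<close>

text \<open>The factors are \<open>P\<^sub>0(a) = F(a, 0)\<close> and \<open>Q\<^sub>0(a, b) = F(a, b) P\<^sub>0(a)\<^sup>-\<^sup>1\<close>. At \<open>b = 0\<close> the equation in \<open>b\<close>
  degenerates to \<open>[X\<^sub>h, P\<^sub>0(a)] = 0\<close>. Therefore \<open>P\<^sub>0(a)\<^sup>-\<^sup>1\<close> is a factor independent of \<open>b\<close> that commutes with \<open>X\<^sub>h\<close>, so that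
  \<open>Q\<^sub>0\<close> still solves the equation in \<open>b\<close>; and \<open>P\<^sub>0(a)\<close> commutes with \<open>b\<^bsup>X\<^sub>h\<^esup>\<close>, so that the
  factorization of the holomorphic part carries over to the solution. By uniqueness any other pair
  of normalized solutions coincides with these. Applied with the variables in either order, this yields
  both decompositions.\<close>

lemma decomposition:
  fixes F :: "complex \<Rightarrow> complex \<Rightarrow> kz_cuea"
  assumes A: "open A" "connected A" "0 \<in> A" "1 \<notin> A" and B: "open B" "connected B" "0 \<in> B" "1 \<notin> B"
    and AB: "\<forall>a\<in>A. \<forall>b\<in>B. a * b \<noteq> 1"
    and U: "log_branch U l" "U \<subseteq> A" "U \<noteq> {}" and V: "log_branch V m" "V \<subseteq> B" "V \<noteq> {}"
    and comm: "kz_X g * kz_X h = kz_X h * kz_X g"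
    and reg_a: "kz_regular A g gg 0 (\<lambda>a. F a 0)"
    and reg_b: "\<forall>a\<in>A. kz_regular B h hh a (F a)"
    and F0: "F 0 0 = 1"
  shows "\<exists>P. ode_fundamental A U l g (coeff1 g gg) P" (is ?P)
    and "\<exists>Q. \<forall>a\<in>A. ode_fundamental B V m h (coeff2 h hh a) (Q a)" (is ?Q)
    and "\<And>P Q. ode_fundamental A U l g (coeff1 g gg) P \<Longrightarrow>
        \<forall>a\<in>A. ode_fundamental B V m h (coeff2 h hh a) (Q a) \<Longrightarrow>
        (\<forall>a\<in>U. \<forall>b\<in>V. F a b * kz_pow l a g * kz_pow m b h = ode_sol m h (Q a) b * ode_sol l g P a) \<and>
        (\<forall>a\<in>A. \<forall>b\<in>B. F a b = Q a b * P a)"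
proof -
  have iff_Q: "ode_fundamental B V m h (coeff2 h hh a) Q \<longleftrightarrow> kz_regular B h hh a Q \<and> Q 0 = 1"
    if "a \<in> A" for a Q
    unfolding ode_fundamental_def using kz_regular_iff_ode_sol[OF B(1,2,4) _ V, of a h hh Q] AB that
    by auto
  \<comment> \<open>the one-variable equation is the one with parameter \<open>0\<close>\<close>
  have "coeff1 g gg = coeff2 g gg 0"
    by (simp add: fun_eq_iff coeff1_def coeff2_def complex_vector.scale_zero_left)
  then have iff_P: "ode_fundamental A U l g (coeff1 g gg) P \<longleftrightarrow> kz_regular A g gg 0 P \<and> P 0 = 1" for P
    unfolding ode_fundamental_def using kz_regular_iff_ode_sol[OF A(1,2,4) _ U, of 0 g gg P] by auto
  define P0 where "P0 = (\<lambda>a. F a 0)"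
  have P0: "kz_regular A g gg 0 P0" "P0 0 = 1" using reg_a F0 by (simp_all add: P0_def)
  then show ?P using iff_P by blast
  \<comment> \<open>the equation in \<open>b\<close>, evaluated at its singular point \<open>b = 0\<close>\<close>
  have P0_comm: "P0 a * kz_X h = kz_X h * P0 a" if "a \<in> A" for a
  proof (rule kz_cuea_eqI, rule component_eqI)
    fix n and \<phi> :: "kz_lie uea \<Rightarrow> complex" assume \<phi>: "complex_functional \<phi>"
    have "0 * deriv (\<lambda>b. \<phi> (component n (F a b))) 0 = \<phi> (component n (kz_op h hh a 0 (F a 0)))"
      using reg_b that B(3) \<phi> unfolding kz_regular_def by blast
    moreover have "kz_op h hh a 0 (F a 0) = kz_X h * P0 a - P0 a * kz_X h"
      by (simp add: kz_op_def P0_def complex_vector.scale_zero_left)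
    ultimately show "\<phi> (component n (P0 a * kz_X h)) = \<phi> (component n (kz_X h * P0 a))"
      by (simp add: component_diff functional_diff[OF \<phi>])
  qed
  have P0_const: "component 0 (P0 a) = 1" if "a \<in> A" for a
    using kz_regular_const_component[OF P0(1) A(1-3) component_kz_op_0 that] P0(2)
    by (simp add: component_one)
  define R where "R = (\<lambda>a. kz_neumann (1 - P0 a))"
  have R: "R a * P0 a = 1" "P0 a * R a = 1" if "a \<in> A" for a
    unfolding R_def using kz_neumann_inverse[OF P0_const[OF that]] .
  have R_comm: "R a * kz_X h = kz_X h * R a" if "a \<in> A" for a
  proof -
    have "R a * kz_X h = R a * (kz_X h * P0 a) * R a" using R[OF that] by (simp add: mult.assoc)
    also have "\<dots> = kz_X h * R a" unfolding P0_comm[OF that, symmetric] using R[OF that]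
      by (simp flip: mult.assoc)
    finally show ?thesis .
  qed
  define Q0 where "Q0 = (\<lambda>a b. F a b * R a)"
  have Q0: "kz_regular B h hh a (Q0 a)" "Q0 a 0 = 1" if "a \<in> A" for a
    using kz_regular_mult_const[OF reg_b[rule_format, OF that] B(1) R_comm[OF that]] R[OF that]
    by (simp_all add: Q0_def P0_def)
  then show ?Q using iff_Q by blast
  fix P Q
  assume P: "ode_fundamental A U l g (coeff1 g gg) P"
    and Q: "\<forall>a\<in>A. ode_fundamental B V m h (coeff2 h hh a) (Q a)"
  have P_eq: "P a = P0 a" if "a \<in> A" for a
  proof (rule kz_regular_unique[OF _ P0(1) _ A(1-3) that])
    show "kz_regular A g gg 0 P" "P 0 = P0 0" using P P0(2) by (simp_all add: iff_P)
  qed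
  have Q_eq: "Q a b = Q0 a b" if "a \<in> A" "b \<in> B" for a b
  proof (rule kz_regular_unique[OF _ Q0(1)[OF that(1)] _ B(1-3) that(2)])
    have "kz_regular B h hh a (Q a) \<and> Q a 0 = 1" using Q iff_Q[OF that(1)] that(1) by blast
    then show "kz_regular B h hh a (Q a)" "Q a 0 = Q0 a 0" using Q0(2)[OF that(1)] by simp_all
  qed
  have hol: "F a b = Q a b * P a" if "a \<in> A" "b \<in> B" for a b
    using R(1)[OF that(1)] by (simp add: P_eq[OF that(1)] Q_eq[OF that] Q0_def mult.assoc)
  have sol: "F a b * kz_pow l a g * kz_pow m b h = ode_sol m h (Q a) b * ode_sol l g P a"
    if "a \<in> U" "b \<in> V" for a b
  proof -
    have ab: "a \<in> A" "b \<in> B" using that U(2) V(2) by auto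
    have "P a * kz_pow m b h = kz_pow m b h * P a"
      unfolding kz_pow_def P_eq[OF ab(1)] by (rule kz_exp_X_commute[OF P0_comm[OF ab(1)]])
    then have "Q a b * (P a * kz_pow m b h) * kz_pow l a g = Q a b * (kz_pow m b h * P a) * kz_pow l a g"
      by simp
    then show ?thesis
      using kz_pow_commute[OF comm, of l a m b] by (simp add: hol[OF ab] ode_sol_def mult.assoc)
  qed
  from hol sol show "(\<forall>a\<in>U. \<forall>b\<in>V. F a b * kz_pow l a g * kz_pow m b h = ode_sol m h (Q a) b * ode_sol l g P a) \<and>
        (\<forall>a\<in>A. \<forall>b\<in>B. F a b = Q a b * P a)" by blast
qed

theorem proposition14:
  fixes D1 D2 U1 U2 :: "complex set"
    and l1 l2 :: "complex \<Rightarrow> complex"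
    and Lh :: "complex \<times> complex \<Rightarrow> kz_cuea"
  assumes "open D1" "connected D1" "0 \<in> D1" "1 \<notin> D1"
    and "open D2" "connected D2" "0 \<in> D2" "1 \<notin> D2"
    and "\<forall>z1\<in>D1. \<forall>z2\<in>D2. z1 * z2 \<noteq> 1"
    and "log_branch U1 l1" "U1 \<subseteq> D1" "U1 \<noteq> {}"
    and "log_branch U2 l2" "U2 \<subseteq> D2" "U2 \<noteq> {}"
    and "kz_fundamental (D1 \<times> D2) (U1 \<times> U2) l1 l2 Lh"
  shows
    "\<comment> \<open>decomposition \<open>2 \<otimes> 1\<close>: \<open>P\<close> is the factor in \<open>z\<^sub>1\<close>, \<open>Q z\<^sub>1\<close> the factor in \<open>z\<^sub>2\<close> with parameter \<open>z\<^sub>1\<close>\<close>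
     (\<exists>P. ode_fundamental D1 U1 l1 X1 (coeff1 X1 X11) P) \<and>
     (\<exists>Q. \<forall>z1\<in>D1. ode_fundamental D2 U2 l2 X2 (coeff2 X2 X22 z1) (Q z1)) \<and>
     (\<forall>P Q.
        ode_fundamental D1 U1 l1 X1 (coeff1 X1 X11) P \<longrightarrow>
        (\<forall>z1\<in>D1. ode_fundamental D2 U2 l2 X2 (coeff2 X2 X22 z1) (Q z1)) \<longrightarrow>
        (\<forall>z1\<in>U1. \<forall>z2\<in>U2. kz_sol l1 l2 Lh (z1, z2) = ode_sol l2 X2 (Q z1) z2 * ode_sol l1 X1 P z1) \<and>
        (\<forall>z1\<in>D1. \<forall>z2\<in>D2. Lh (z1, z2) = Q z1 z2 * P z1)) \<and>
     \<comment> \<open>decomposition \<open>1 \<otimes> 2\<close>: \<open>P\<close> is the factor in \<open>z\<^sub>2\<close>, \<open>Q z\<^sub>2\<close> the factor in \<open>z\<^sub>1\<close> with parameter \<open>z\<^sub>2\<close>\<close>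
     (\<exists>P. ode_fundamental D2 U2 l2 X2 (coeff1 X2 X22) P) \<and>
     (\<exists>Q. \<forall>z2\<in>D2. ode_fundamental D1 U1 l1 X1 (coeff2 X1 X11 z2) (Q z2)) \<and>
     (\<forall>P Q.
        ode_fundamental D2 U2 l2 X2 (coeff1 X2 X22) P \<longrightarrow>
        (\<forall>z2\<in>D2. ode_fundamental D1 U1 l1 X1 (coeff2 X1 X11 z2) (Q z2)) \<longrightarrow>
        (\<forall>z1\<in>U1. \<forall>z2\<in>U2. kz_sol l1 l2 Lh (z1, z2) = ode_sol l1 X1 (Q z2) z1 * ode_sol l2 X2 P z2) \<and>
        (\<forall>z1\<in>D1. \<forall>z2\<in>D2. Lh (z1, z2) = Q z2 z1 * P z2))"
proof -
  note D1 = assms(1-4) and D2 = assms(5-8) and ne = assms(9) and U1 = assms(10-12) and U2 = assms(13-15)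
  have reg1: "\<forall>z2\<in>D2. kz_regular D1 X1 X11 z2 (\<lambda>z1. Lh (z1, z2))"
    using kz_fundamental_kz_regular(1)[OF D1(1,2,4) D2(1,2,4) ne U1 U2 assms(16)] by blast
  have reg2: "\<forall>z1\<in>D1. kz_regular D2 X2 X22 z1 (\<lambda>z2. Lh (z1, z2))"
    using kz_fundamental_kz_regular(2)[OF D1(1,2,4) D2(1,2,4) ne U1 U2 assms(16)] by blast
  have Lh0: "Lh (0, 0) = 1" using assms(16) by (simp add: kz_fundamental_def)
  have ne': "\<forall>z2\<in>D2. \<forall>z1\<in>D1. z2 * z1 \<noteq> 1" using ne by (metis mult.commute)
  note d1 = decomposition[where F = "\<lambda>z1 z2. Lh (z1, z2)", OF D1 D2 ne U1 U2 X1_X2_commute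
      bspec[OF reg1 D2(3)] reg2 Lh0]
  note d2 = decomposition[where F = "\<lambda>z2 z1. Lh (z1, z2)", OF D2 D1 ne' U2 U1 X1_X2_commute[symmetric]
      bspec[OF reg2 D1(3)] reg1 Lh0]
  have sol: "kz_sol l1 l2 Lh (z1, z2) = Lh (z1, z2) * kz_pow l1 z1 X1 * kz_pow l2 z2 X2"
    "kz_sol l1 l2 Lh (z1, z2) = Lh (z1, z2) * kz_pow l2 z2 X2 * kz_pow l1 z1 X1" for z1 z2
    by (simp_all add: kz_sol_def mult.assoc kz_pow_commute[OF X1_X2_commute])
  show ?thesis
  proof (intro conjI allI impI)
    fix P Q
    assume PQ: "ode_fundamental D1 U1 l1 X1 (coeff1 X1 X11) P"
      "\<forall>z1\<in>D1. ode_fundamental D2 U2 l2 X2 (coeff2 X2 X22 z1) (Q z1)"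
    show "\<forall>z1\<in>U1. \<forall>z2\<in>U2. kz_sol l1 l2 Lh (z1, z2) = ode_sol l2 X2 (Q z1) z2 * ode_sol l1 X1 P z1"
      "\<forall>z1\<in>D1. \<forall>z2\<in>D2. Lh (z1, z2) = Q z1 z2 * P z1"
      using d1(3)[OF PQ] unfolding sol(1) by blast+
  next
    fix P Q
    assume PQ: "ode_fundamental D2 U2 l2 X2 (coeff1 X2 X22) P"
      "\<forall>z2\<in>D2. ode_fundamental D1 U1 l1 X1 (coeff2 X1 X11 z2) (Q z2)"
    show "\<forall>z1\<in>U1. \<forall>z2\<in>U2. kz_sol l1 l2 Lh (z1, z2) = ode_sol l1 X1 (Q z2) z1 * ode_sol l2 X2 P z2"
      "\<forall>z1\<in>D1. \<forall>z2\<in>D2. Lh (z1, z2) = Q z2 z1 * P z2"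
      using d2(3)[OF PQ] unfolding sol(2) by blast+
  qed (fact d1(1) d1(2) d2(1) d2(2))+
qed

end
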